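(* Let $\mathcal{H}$ be a separable complex Hilbert space and $A$ a self-adjoint operator on $\mathcal{H}$ for which there is an orthonormal basis $(v_\alpha)_{\alpha\in\mathcal{I}}$ of $\mathcal{H}$ ($\mathcal{I}$ a countable index set) with $Av_\alpha=m_\alpha v_\alpha$, $m_\alpha\in\mathbb{R}$. Let $\mathcal{I}_0\subset\mathcal{I}$ and let $K$ be the orthogonal projection of $\mathcal{H}$ onto $\overline{\mathrm{span}}\{v_\alpha\}_{\alpha\in\mathcal{I}_0}$. For $n\ge0$, $\alpha_1,\dots,\alpha_n\in\mathcal{I}\setminus\mathcal{I}_0$ and $\beta_1,\dots,\beta_n\in\mathcal{I}_0$ put $$v_{\alpha_1,\dots,\alpha_n;\beta_1,\dots,\beta_n}:=\rho_K(a^*(v_{\alpha_1})\cdots a^*(v_{\alpha_n})a(v_{\beta_1})\cdots a(v_{\beta_n}))\Omega_K.$$ Let $$\mathcal{A}:=\sum_{\alpha\in\mathcal{I}\setminus\mathcal{I}_0}m_\alpha\,\rho_K(a^*(v_\alpha)a(v_\alpha))-\sum_{\alpha\in\mathcal{I}_0}m_\alpha\,\rho_K(a(v_\alpha)a^*(v_\alpha)),$$ defined on the linear span of the vectors $v_{\alpha_1,\dots,\alpha_n;\beta_1,\dots,\beta_n}$. Then the closure of $\mathcal{A}$ coincides with $d\Gamma_K(A)$.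
   Context: Inner products are linear in the first argument. The CAR algebra $\mathfrak{A}(\mathcal{H})$ is the universal unital $C^*$-algebra generated by $a(h)$ ($h\in\mathcal{H}$) such that $h\mapsto a^*(h):=a(h)^*$ is linear and $a(h)a(k)+a(k)a(h)=0$, $a^*(h)a(k)+a(k)a^*(h)=\langle h,k\rangle1$. For a unitary $U$ on $\mathcal{H}$, $\gamma_U$ is the $*$-automorphism with $\gamma_U(a(h))=a(Uh)$. The GICAR algebra $\mathfrak{I}(\mathcal{H})$ is the fixed-point algebra of $\{\gamma_{\lambda1}\}_{\lambda\in\mathbb{T}}$. The quasi-free state $\varphi_K$ is the unique state with $\varphi_K(a^*(h_n)\cdots a^*(h_1)a(k_1)\cdots a(k_m))=\delta_{n,m}\det[\langle Kh_i,k_j\rangle]_{i,j=1}^n$, and $(\rho_K,\mathcal{H}_K,\Omega_K)$ is the GNS triple of $\varphi_K|_{\mathfrak{I}(\mathcal{H})}$. Put $U_t:=e^{\mathrm{i}tA}$. Since $K$ commutes with $U_t$, there is a unique strongly continuous unitary group $(\Gamma_K(U_t))_{t\in\mathbb{R}}$ on $\mathcal{H}_K$ with $\Gamma_K(U_t)\rho_K(x)\Omega_K=\rho_K(\gamma_{U_t}(x))\Omega_K$ for $x\in\mathfrak{I}(\mathcal{H})$; $d\Gamma_K(A)$ is the self-adjoint operator with $\Gamma_K(U_t)=e^{\mathrm{i}t\,d\Gamma_K(A)}$. On each vector $v_{\alpha_1,\dots,\alpha_n;\beta_1,\dots,\beta_n}$ only finitely many terms of the sums defining $\mathcal{A}$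 are nonzero. For $n=0$ the vector is $\Omega_K$. *)

theory Defs
  imports
    "HOL-Analysis.Analysis"
    "HOL-Algebra.Ring"
    "Jordan_Normal_Form.Determinant"
begin

section \<open>Complex Hilbert spaces\<close>

text \<open>Norm and topology are those of the underlying real inner product space; the complex inner
  product is linear in its first argument and its real part is the real inner product.\<close>

class complex_inner = real_inner +
  fixes scaleC :: "complex \<Rightarrow> 'a \<Rightarrow> 'a" (infixr \<open>*\<^sub>C\<close> 75)
    and cinner :: "'a \<Rightarrow> 'a \<Rightarrow> complex"
  assumes scaleC_add_right: "c *\<^sub>C (x + y) = c *\<^sub>C x + c *\<^sub>C y"
    and scaleC_add_left: "(c + d) *\<^sub>C x = c *\<^sub>C x + d *\<^sub>C x"
    and scaleC_scaleC: "c *\<^sub>C d *\<^sub>C x = (c * d) *\<^sub>C x"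
    and scaleC_of_real: "complex_of_real r *\<^sub>C x = r *\<^sub>R x"
    and cinner_add_left: "cinner (x + y) z = cinner x z + cinner y z"
    and cinner_scaleC_left: "cinner (c *\<^sub>C x) y = c * cinner x y"
    and cinner_commute: "cinner x y = cnj (cinner y x)"
    and Re_cinner: "Re (cinner x y) = inner x y"

class complex_hilbert = complex_inner + complete_space

global_interpretation complex_vector:
  vector_space "scaleC :: complex \<Rightarrow> 'a::complex_inner \<Rightarrow> 'a"
  defines cspan = complex_vector.span
    and csubspace = complex_vector.subspace
proof
  show "1 *\<^sub>C x = x" for x :: 'a
    using scaleC_of_real[of 1 x] by simp
qed (simp_all add: scaleC_add_right scaleC_add_left scaleC_scaleC)

definition orthonormal_basis :: "'i set \<Rightarrow> ('i \<Rightarrow> 'h::complex_inner) \<Rightarrow> bool" where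
  "orthonormal_basis I v \<longleftrightarrow>
     (\<forall>\<alpha>\<in>I. \<forall>\<beta>\<in>I. cinner (v \<alpha>) (v \<beta>) = (if \<alpha> = \<beta> then 1 else 0)) \<and>
     closure (cspan (v ` I)) = UNIV"

definition bounded_clinear :: "('h::complex_inner \<Rightarrow> 'k::complex_inner) \<Rightarrow> bool" where
  "bounded_clinear T \<longleftrightarrow> bounded_linear T \<and> (\<forall>c x. T (c *\<^sub>C x) = c *\<^sub>C T x)"

definition unitary_op :: "('h::complex_inner \<Rightarrow> 'h) \<Rightarrow> bool" where
  "unitary_op V \<longleftrightarrow>
     bounded_clinear V \<and> surj V \<and> (\<forall>x y. cinner (V x) (V y) = cinner x y)"

definition orth_proj_onto :: "'h::complex_inner set \<Rightarrow> ('h \<Rightarrow> 'h) \<Rightarrow> bool" where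
  "orth_proj_onto M P \<longleftrightarrow>
     csubspace M \<and> closed M \<and> (\<forall>x. P x \<in> M \<and> (\<forall>y\<in>M. cinner (x - P x) y = 0))"


section \<open>Unbounded operators and the unitary groups they generate\<close>

text \<open>An unbounded operator is represented by its graph, so that the closure of an operator is the
  topological closure of a set of pairs.\<close>

definition linear_graph :: "('h::complex_inner \<times> 'h) set \<Rightarrow> bool" where
  "linear_graph T \<longleftrightarrow>
     (0, 0) \<in> T \<and>
     (\<forall>(x, y)\<in>T. \<forall>(x', y')\<in>T. (x + x', y + y') \<in> T) \<and>
     (\<forall>c. \<forall>(x, y)\<in>T. (c *\<^sub>C x, c *\<^sub>C y) \<in> T) \<and>
     single_valued T"

definition adjoint_graph :: "('h::complex_inner \<times> 'h) set \<Rightarrow> ('h \<times> 'h) set" where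
  "adjoint_graph T = {(y, z). \<forall>(x, w)\<in>T. cinner w y = cinner x z}"

definition self_adjoint :: "('h::complex_inner \<times> 'h) set \<Rightarrow> bool" where
  "self_adjoint T \<longleftrightarrow> linear_graph T \<and> closure (Domain T) = UNIV \<and> adjoint_graph T = T"

definition spectral_measure :: "(real set \<Rightarrow> 'h::complex_inner \<Rightarrow> 'h) \<Rightarrow> bool" where
  "spectral_measure E \<longleftrightarrow>
     (\<forall>S\<in>sets borel. \<exists>M. orth_proj_onto M (E S)) \<and>
     E UNIV = id \<and>
     (\<forall>S\<in>sets borel. \<forall>S'\<in>sets borel. E (S \<inter> S') = E S \<circ> E S') \<and>
     (\<forall>F. range F \<subseteq> sets borel \<longrightarrow> disjoint_family F \<longrightarrow>
        (\<forall>x. (\<lambda>n::nat. E (F n) x) sums E (\<Union>n. F n) x))"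

definition spectral_distr :: "(real set \<Rightarrow> 'h::complex_inner \<Rightarrow> 'h) \<Rightarrow> 'h \<Rightarrow> real measure" where
  "spectral_distr E x = measure_of UNIV (sets borel) (\<lambda>S. ennreal (Re (cinner (E S x) x)))"

text \<open>\<open>T = \<integral> s dE(s)\<close>; off the diagonal, the inner products are determined by polarization.\<close>

definition spectral_resolution ::
    "(real set \<Rightarrow> 'h::complex_inner \<Rightarrow> 'h) \<Rightarrow> ('h \<times> 'h) set \<Rightarrow> bool" where
  "spectral_resolution E T \<longleftrightarrow>
     spectral_measure E \<and>
     Domain T = {x. integrable (spectral_distr E x) (\<lambda>s. s\<^sup>2)} \<and>
     (\<forall>(x, y)\<in>T. cinner y x = complex_of_real (LINT s|spectral_distr E x. s))"

text \<open>\<open>V t = exp (i t T)\<close> for a self-adjoint \<open>T\<close>, in the sense of the Borel functional calculus.\<close>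

definition is_exp_group :: "('h::complex_inner \<times> 'h) set \<Rightarrow> (real \<Rightarrow> 'h \<Rightarrow> 'h) \<Rightarrow> bool" where
  "is_exp_group T V \<longleftrightarrow>
     (\<exists>E. spectral_resolution E T \<and>
        (\<forall>t. bounded_clinear (V t) \<and>
           (\<forall>x. cinner (V t x) x = (LINT s|spectral_distr E x. exp (\<i> * complex_of_real (t * s))))))"

definition strongly_continuous_unitary_group :: "(real \<Rightarrow> 'h::complex_inner \<Rightarrow> 'h) \<Rightarrow> bool" where
  "strongly_continuous_unitary_group V \<longleftrightarrow>
     (\<forall>t. unitary_op (V t)) \<and> V 0 = id \<and> (\<forall>s t. V (s + t) = V s \<circ> V t) \<and>
     (\<forall>x. continuous_on UNIV (\<lambda>t. V t x))"


section \<open>Unital C*-algebras\<close>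

text \<open>C*-algebras have explicit carriers, since the universal property of the CAR algebra quantifies
  over them.\<close>

record 'a cstar_alg = "'a ring" +
  cscale :: "complex \<Rightarrow> 'a \<Rightarrow> 'a"
  star :: "'a \<Rightarrow> 'a"
  cnorm :: "'a \<Rightarrow> real"

locale unital_cstar_algebra = ring A for A :: "'a cstar_alg" (structure) +
  assumes cscale_closed: "x \<in> carrier A \<Longrightarrow> cscale A c x \<in> carrier A"
    and cscale_add_right: "\<lbrakk>x \<in> carrier A; y \<in> carrier A\<rbrakk> \<Longrightarrow>
      cscale A c (x \<oplus> y) = cscale A c x \<oplus> cscale A c y"
    and cscale_add_left: "x \<in> carrier A \<Longrightarrow>
      cscale A (c + d) x = cscale A c x \<oplus> cscale A d x"
    and cscale_cscale: "x \<in> carrier A \<Longrightarrow> cscale A c (cscale A d x) = cscale A (c * d) x"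
    and cscale_one: "x \<in> carrier A \<Longrightarrow> cscale A 1 x = x"
    and cscale_mult_left: "\<lbrakk>x \<in> carrier A; y \<in> carrier A\<rbrakk> \<Longrightarrow>
      cscale A c x \<otimes> y = cscale A c (x \<otimes> y)"
    and cscale_mult_right: "\<lbrakk>x \<in> carrier A; y \<in> carrier A\<rbrakk> \<Longrightarrow>
      x \<otimes> cscale A c y = cscale A c (x \<otimes> y)"
    and star_closed: "x \<in> carrier A \<Longrightarrow> star A x \<in> carrier A"
    and star_star: "x \<in> carrier A \<Longrightarrow> star A (star A x) = x"
    and star_add: "\<lbrakk>x \<in> carrier A; y \<in> carrier A\<rbrakk> \<Longrightarrow>
      star A (x \<oplus> y) = star A x \<oplus> star A y"
    and star_cscale: "x \<in> carrier A \<Longrightarrow> star A (cscale A c x) = cscale A (cnj c) (star A x)"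
    and star_mult: "\<lbrakk>x \<in> carrier A; y \<in> carrier A\<rbrakk> \<Longrightarrow>
      star A (x \<otimes> y) = star A y \<otimes> star A x"
    and cnorm_nonneg: "x \<in> carrier A \<Longrightarrow> 0 \<le> cnorm A x"
    and cnorm_eq_0: "x \<in> carrier A \<Longrightarrow> cnorm A x = 0 \<longleftrightarrow> x = \<zero>"
    and cnorm_triangle: "\<lbrakk>x \<in> carrier A; y \<in> carrier A\<rbrakk> \<Longrightarrow>
      cnorm A (x \<oplus> y) \<le> cnorm A x + cnorm A y"
    and cnorm_cscale: "x \<in> carrier A \<Longrightarrow> cnorm A (cscale A c x) = cmod c * cnorm A x"
    and cnorm_mult: "\<lbrakk>x \<in> carrier A; y \<in> carrier A\<rbrakk> \<Longrightarrow>
      cnorm A (x \<otimes> y) \<le> cnorm A x * cnorm A y"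
    and cstar_identity: "x \<in> carrier A \<Longrightarrow> cnorm A (star A x \<otimes> x) = (cnorm A x)\<^sup>2"
    and complete: "\<lbrakk>range X \<subseteq> carrier A;
        \<forall>e>0. \<exists>N. \<forall>m\<ge>N. \<forall>n\<ge>N. cnorm A (X m \<ominus> X n) < e\<rbrakk> \<Longrightarrow>
      \<exists>x\<in>carrier A. (\<lambda>n::nat. cnorm A (X n \<ominus> x)) \<longlonglongrightarrow> 0"

definition star_hom :: "'a cstar_alg \<Rightarrow> 'b cstar_alg \<Rightarrow> ('a \<Rightarrow> 'b) \<Rightarrow> bool" where
  "star_hom A B \<pi> \<longleftrightarrow>
     \<pi> \<in> ring_hom A B \<and>
     (\<forall>x\<in>carrier A. \<forall>c. \<pi> (cscale A c x) = cscale B c (\<pi> x)) \<and>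
     (\<forall>x\<in>carrier A. \<pi> (star A x) = star B (\<pi> x))"

definition star_automorphism :: "'a cstar_alg \<Rightarrow> ('a \<Rightarrow> 'a) \<Rightarrow> bool" where
  "star_automorphism A g \<longleftrightarrow> star_hom A A g \<and> bij_betw g (carrier A) (carrier A)"

definition closed_star_subalgebra :: "'a cstar_alg \<Rightarrow> 'a set \<Rightarrow> bool" where
  "closed_star_subalgebra A S \<longleftrightarrow>
     S \<subseteq> carrier A \<and> \<one>\<^bsub>A\<^esub> \<in> S \<and>
     (\<forall>x\<in>S. \<forall>y\<in>S. x \<oplus>\<^bsub>A\<^esub> y \<in> S \<and> x \<otimes>\<^bsub>A\<^esub> y \<in> S) \<and>
     (\<forall>x\<in>S. star A x \<in> S \<and> (\<forall>c. cscale A c x \<in> S)) \<and>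
     (\<forall>X. \<forall>x\<in>carrier A. range X \<subseteq> S \<longrightarrow>
        (\<lambda>n::nat. cnorm A (X n \<ominus>\<^bsub>A\<^esub> x)) \<longlonglongrightarrow> 0 \<longrightarrow> x \<in> S)"

definition is_state :: "'a cstar_alg \<Rightarrow> ('a \<Rightarrow> complex) \<Rightarrow> bool" where
  "is_state A \<phi> \<longleftrightarrow>
     (\<forall>x\<in>carrier A. \<forall>y\<in>carrier A. \<phi> (x \<oplus>\<^bsub>A\<^esub> y) = \<phi> x + \<phi> y) \<and>
     (\<forall>x\<in>carrier A. \<forall>c. \<phi> (cscale A c x) = c * \<phi> x) \<and>
     (\<forall>x\<in>carrier A. Im (\<phi> (star A x \<otimes>\<^bsub>A\<^esub> x)) = 0 \<and> 0 \<le> Re (\<phi> (star A x \<otimes>\<^bsub>A\<^esub> x))) \<and>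
     \<phi> \<one>\<^bsub>A\<^esub> = 1"

definition mprod :: "'a cstar_alg \<Rightarrow> 'a list \<Rightarrow> 'a" where
  "mprod A xs = foldr (\<lambda>x y. x \<otimes>\<^bsub>A\<^esub> y) xs \<one>\<^bsub>A\<^esub>"

text \<open>GNS triple of the restriction of \<open>\<phi>\<close> to a unital *-subalgebra \<open>S\<close> of \<open>A\<close>.\<close>

definition gns_triple ::
    "'a cstar_alg \<Rightarrow> 'a set \<Rightarrow> ('a \<Rightarrow> complex) \<Rightarrow> ('a \<Rightarrow> 'k::complex_hilbert \<Rightarrow> 'k) \<Rightarrow> 'k \<Rightarrow> bool" where
  "gns_triple A S \<phi> \<rho> \<Omega> \<longleftrightarrow>
     (\<forall>x\<in>S. bounded_clinear (\<rho> x)) \<and>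
     (\<forall>x\<in>S. \<forall>y\<in>S. \<forall>\<xi>. \<rho> (x \<oplus>\<^bsub>A\<^esub> y) \<xi> = \<rho> x \<xi> + \<rho> y \<xi> \<and> \<rho> (x \<otimes>\<^bsub>A\<^esub> y) \<xi> = \<rho> x (\<rho> y \<xi>)) \<and>
     (\<forall>x\<in>S. \<forall>c \<xi>. \<rho> (cscale A c x) \<xi> = c *\<^sub>C \<rho> x \<xi>) \<and>
     (\<forall>x\<in>S. \<forall>\<xi> \<eta>. cinner (\<rho> (star A x) \<xi>) \<eta> = cinner \<xi> (\<rho> x \<eta>)) \<and>
     \<rho> \<one>\<^bsub>A\<^esub> = id \<and>
     closure ((\<lambda>x. \<rho> x \<Omega>) ` S) = UNIV \<and>
     (\<forall>x\<in>S. cinner (\<rho> x \<Omega>) \<Omega> = \<phi> x)"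


section \<open>CAR and GICAR algebras, quasi-free states\<close>

definition car_relations :: "'a cstar_alg \<Rightarrow> ('h::complex_inner \<Rightarrow> 'a) \<Rightarrow> bool" where
  "car_relations A a \<longleftrightarrow>
     range a \<subseteq> carrier A \<and>
     (\<forall>h k. star A (a (h + k)) = star A (a h) \<oplus>\<^bsub>A\<^esub> star A (a k)) \<and>
     (\<forall>c h. star A (a (c *\<^sub>C h)) = cscale A c (star A (a h))) \<and>
     (\<forall>h k. a h \<otimes>\<^bsub>A\<^esub> a k \<oplus>\<^bsub>A\<^esub> a k \<otimes>\<^bsub>A\<^esub> a h = \<zero>\<^bsub>A\<^esub>) \<and>
     (\<forall>h k. star A (a h) \<otimes>\<^bsub>A\<^esub> a k \<oplus>\<^bsub>A\<^esub> a k \<otimes>\<^bsub>A\<^esub> star A (a h) = cscale A (cinner h k) \<one>\<^bsub>A\<^esub>)"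

text \<open>The test algebras \<open>B\<close> of the universal property live on subsets of the same type \<open>'a\<close>. For
  separable \<open>'h\<close> and \<open>A\<close> nonzero this loses nothing: an algebra generated by a solution of the
  relations has at most the cardinality of the continuum, which a nonzero complex algebra attains,
  so an isomorphic copy of it lives on a subset of \<open>'a\<close>.\<close>

definition is_car_algebra :: "'a cstar_alg \<Rightarrow> ('h::complex_inner \<Rightarrow> 'a) \<Rightarrow> bool" where
  "is_car_algebra A a \<longleftrightarrow>
     unital_cstar_algebra A \<and> car_relations A a \<and>
     (\<forall>S. closed_star_subalgebra A S \<and> range a \<subseteq> S \<longrightarrow> S = carrier A) \<and>
     (\<forall>(B :: 'a cstar_alg) b. unital_cstar_algebra B \<and> car_relations B b \<longrightarrow>
        (\<exists>!\<pi>. \<pi> \<in> extensional (carrier A) \<and> star_hom A B \<pi> \<and> (\<forall>h. \<pi> (a h) = b h)))"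

definition car_aut ::
    "'a cstar_alg \<Rightarrow> ('h::complex_inner \<Rightarrow> 'a) \<Rightarrow> ('h \<Rightarrow> 'h) \<Rightarrow> 'a \<Rightarrow> 'a" where
  "car_aut A a U =
     (THE g. g \<in> extensional (carrier A) \<and> star_automorphism A g \<and> (\<forall>h. g (a h) = a (U h)))"

definition gicar :: "'a cstar_alg \<Rightarrow> ('h::complex_inner \<Rightarrow> 'a) \<Rightarrow> 'a set" where
  "gicar A a = {x \<in> carrier A. \<forall>z. cmod z = 1 \<longrightarrow> car_aut A a (\<lambda>h. z *\<^sub>C h) x = x}"

definition is_quasi_free_state ::
    "'a cstar_alg \<Rightarrow> ('h::complex_inner \<Rightarrow> 'a) \<Rightarrow> ('h \<Rightarrow> 'h) \<Rightarrow> ('a \<Rightarrow> complex) \<Rightarrow> bool" where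
  "is_quasi_free_state A a K \<phi> \<longleftrightarrow>
     is_state A \<phi> \<and>
     (\<forall>hs ks. \<phi> (mprod A (map (\<lambda>h. star A (a h)) (rev hs) @ map a ks)) =
        (if length hs = length ks
         then Determinant.det
           (Matrix.mat (length hs) (length hs) (\<lambda>(i, j). cinner (K (hs ! i)) (ks ! j)))
         else 0))"


section \<open>The second-quantized operator\<close>

definition excitation_vector ::
    "'a cstar_alg \<Rightarrow> ('h::complex_inner \<Rightarrow> 'a) \<Rightarrow> ('a \<Rightarrow> 'k \<Rightarrow> 'k) \<Rightarrow> 'k \<Rightarrow> ('i \<Rightarrow> 'h) \<Rightarrow>
     'i list \<Rightarrow> 'i list \<Rightarrow> 'k" where
  "excitation_vector A a \<rho> \<Omega> v \<alpha>s \<beta>s =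
     \<rho> (mprod A (map (\<lambda>\<alpha>. star A (a (v \<alpha>))) \<alpha>s @ map (\<lambda>\<beta>. a (v \<beta>)) \<beta>s)) \<Omega>"

definition excitation_span ::
    "'a cstar_alg \<Rightarrow> ('h::complex_inner \<Rightarrow> 'a) \<Rightarrow> ('a \<Rightarrow> 'k \<Rightarrow> 'k) \<Rightarrow> 'k::complex_inner \<Rightarrow>
     ('i \<Rightarrow> 'h) \<Rightarrow> 'i set \<Rightarrow> 'i set \<Rightarrow> 'k set" where
  "excitation_span A a \<rho> \<Omega> v I I0 =
     cspan {excitation_vector A a \<rho> \<Omega> v \<alpha>s \<beta>s | \<alpha>s \<beta>s.
       length \<alpha>s = length \<beta>s \<and> set \<alpha>s \<subseteq> I - I0 \<and> set \<beta>s \<subseteq> I0}"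

text \<open>On the stated domain both sums have only finitely many nonzero terms.\<close>

definition second_quantized_graph ::
    "'a cstar_alg \<Rightarrow> ('h::complex_inner \<Rightarrow> 'a) \<Rightarrow> ('a \<Rightarrow> 'k \<Rightarrow> 'k) \<Rightarrow> 'k::complex_inner \<Rightarrow>
     ('i \<Rightarrow> 'h) \<Rightarrow> ('i \<Rightarrow> real) \<Rightarrow> 'i set \<Rightarrow> 'i set \<Rightarrow> ('k \<times> 'k) set" where
  "second_quantized_graph A a \<rho> \<Omega> v m I I0 =
     {(\<psi>, (\<Sum>\<^sub>\<infinity>\<alpha>\<in>I - I0. m \<alpha> *\<^sub>R \<rho> (star A (a (v \<alpha>)) \<otimes>\<^bsub>A\<^esub> a (v \<alpha>)) \<psi>)
         - (\<Sum>\<^sub>\<infinity>\<alpha>\<in>I0. m \<alpha> *\<^sub>R \<rho> (a (v \<alpha>) \<otimes>\<^bsub>A\<^esub> star A (a (v \<alpha>))) \<psi>))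
       | \<psi>. \<psi> \<in> excitation_span A a \<rho> \<Omega> v I I0}"

end

theory Submission
  imports Defs
begin

text \<open>
  The excitation vectors are eigenvectors of both operators, with the same eigenvalues, and they are
  total in the GNS space. This suffices: on eigenvectors with real eigenvalues \<open>r\<close>, the operator
  \<open>\<A> + \<i>\<close> acts as \<open>r + \<i> \<noteq> 0\<close>, so its range is dense, and a self-adjoint extension of an operator
  with this property is its closure (\<open>closure_eq_self_adjoint\<close>).

  \<^emph>\<open>Eigenvalues of\<close> \<open>\<A>\<close>. Commutation with \<open>a(v\<^sub>\<gamma>)\<^sup>* a(v\<^sub>\<gamma>)\<close> or \<open>a(v\<^sub>\<gamma>) a(v\<^sub>\<gamma>)\<^sup>*\<close> is a derivation with
  the monomials as eigenvectors, and the one of these two elements that occurs in \<open>\<A>\<close> annihilates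
  the vacuum. So each summand of \<open>\<A>\<close> counts the occurrences of an index in an excitation vector, and
  the eigenvalue is \<open>\<Sum> m\<^bsub>\<alpha>\<^esub> - \<Sum> m\<^bsub>\<beta>\<^esub>\<close> (\<open>number_word\<close>, \<open>acts_exc\<close>).

  \<^emph>\<open>Eigenvalues of the generator.\<close> The unitary group of a self-adjoint operator and the operator itself
  have the same eigenvectors: in both directions the spectral distribution of the vector is a point
  mass, and a quadratic form that is an integral against the spectral distributions is diagonal
  there (\<open>quadratic_form_eigenvector\<close>). From \<open>A v\<^sub>\<alpha> = m\<^sub>\<alpha> v\<^sub>\<alpha>\<close> one obtains
  \<open>U\<^sub>t v\<^sub>\<alpha> = exp (\<i> t m\<^sub>\<alpha>) v\<^sub>\<alpha>\<close>, hence the action of \<open>\<gamma>\<close> on monomials and the eigenvalues of \<open>\<Gamma> t\<close>, and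
  from these the eigenvalues of the generator of \<open>\<Gamma>\<close>.

  \<^emph>\<open>Totality.\<close> Approximation is measured by the seminorms \<open>\<psi>(x\<^sup>* x)\<^bsup>1/2\<^esup>\<close> of all states \<open>\<psi>\<close> for which
  these seminorms vanish on the annihilators of the vacuum. Left multiplication is continuous for
  them, uniformly in \<open>\<psi>\<close>, because a self-adjoint element near \<open>1\<close> of a C*-algebra is a square
  (\<open>sq_norm_mult_le\<close>). So the elements that, together with their adjoints, preserve approximability
  by excitation monomials under left multiplication form a closed *-subalgebra. It contains the
  \<open>a(v\<^sub>\<gamma>)\<close> by normal ordering, and hence every element of the CAR algebra is approximable
  (\<open>approx_all\<close>). For a gauge-invariant element, averaging over gauge transformations removes the
  monomials of nonzero degree (\<open>gicar_approx\<close>).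
\<close>

section \<open>Complex inner product spaces\<close>

lemma cinner_add_right: "cinner x (y + z) = cinner x y + cinner x z"
  by (metis cinner_add_left cinner_commute complex_cnj_add)

lemma cinner_scaleC_right: "cinner x (c *\<^sub>C y) = cnj c * cinner x y"
  by (metis cinner_commute cinner_scaleC_left complex_cnj_mult)

lemma scaleR_eq_scaleC: "r *\<^sub>R x = complex_of_real r *\<^sub>C x"
  by (simp add: scaleC_of_real)

lemma cinner_scaleR_left: "cinner (r *\<^sub>R x) y = r * cinner x y"
  by (simp add: scaleR_eq_scaleC cinner_scaleC_left)

lemma cinner_scaleR_right: "cinner x (r *\<^sub>R y) = r * cinner x y"
  by (simp add: scaleR_eq_scaleC cinner_scaleC_right)

lemma cinner_zero_left [simp]: "cinner 0 y = 0"
  using cinner_scaleR_left[of 0 0 y] by simp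

lemma cinner_zero_right [simp]: "cinner x 0 = 0"
  using cinner_scaleR_right[of x 0 0] by simp

lemma cinner_minus_left: "cinner (- x) y = - cinner x y"
  using cinner_scaleR_left[of "-1" x y] by simp

lemma cinner_minus_right: "cinner x (- y) = - cinner x y"
  using cinner_scaleR_right[of x "-1" y] by simp

lemma cinner_diff_left: "cinner (x - y) z = cinner x z - cinner y z"
  using cinner_add_left[of x "- y" z] by (simp add: cinner_minus_left)

lemma cinner_diff_right: "cinner x (y - z) = cinner x y - cinner x z"
  using cinner_add_right[of x y "- z"] by (simp add: cinner_minus_right)

lemmas cinner_simps = cinner_add_left cinner_add_right cinner_diff_left cinner_diff_right
  cinner_scaleC_left cinner_scaleC_right cinner_scaleR_left cinner_scaleR_right
  cinner_minus_left cinner_minus_right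

lemma cinner_self: "cinner x x = complex_of_real ((norm x)\<^sup>2)"
proof -
  have "Im (cinner x x) = 0"
    using arg_cong[OF cinner_commute[of x x], of Im] by simp
  then show ?thesis
    by (simp add: complex_eq_iff Re_cinner power2_norm_eq_inner)
qed

lemma cinner_self_eq_0 [simp]: "cinner x x = 0 \<longleftrightarrow> x = 0"
  by (simp add: cinner_self)

lemma norm_scaleC: "norm (c *\<^sub>C x) = cmod c * norm x"
proof -
  have "complex_of_real ((norm (c *\<^sub>C x))\<^sup>2) = complex_of_real ((cmod c)\<^sup>2 * (norm x)\<^sup>2)"
    unfolding cinner_self[symmetric] cinner_scaleC_left cinner_scaleC_right
    by (simp add: cinner_self complex_norm_square[symmetric] mult.assoc[symmetric] mult.commute[of "cnj c"])
  then have "(norm (c *\<^sub>C x))\<^sup>2 = (cmod c * norm x)\<^sup>2"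
    by (simp add: power_mult_distrib flip: of_real_power of_real_mult)
  then show ?thesis
    by (simp add: power2_eq_iff_nonneg)
qed

lemma scaleC_diff_right: "c *\<^sub>C (x - y) = c *\<^sub>C x - c *\<^sub>C y"
  by (rule complex_vector.scale_right_diff_distrib)

lemma bounded_linear_scaleC: "bounded_linear (\<lambda>x. c *\<^sub>C x)"
proof (rule bounded_linear_intro[where K="cmod c"])
  show "c *\<^sub>C (r *\<^sub>R x) = r *\<^sub>R c *\<^sub>C x" for r x
    by (simp add: scaleR_eq_scaleC scaleC_scaleC mult.commute)
qed (simp_all add: scaleC_add_right norm_scaleC)

lemma cinner_eq_Complex: "cinner x y = Complex (inner x y) (- inner (\<i> *\<^sub>C x) y)"
  by (simp add: complex_eq_iff Re_cinner[symmetric] cinner_scaleC_left)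

lemma tendsto_cinner:
  assumes "(f \<longlongrightarrow> x) F" and "(g \<longlongrightarrow> y) F"
  shows "((\<lambda>t. cinner (f t) (g t)) \<longlongrightarrow> cinner x y) F"
proof -
  have "((\<lambda>t. Complex (inner (f t) (g t)) (- inner (\<i> *\<^sub>C f t) (g t)))
      \<longlongrightarrow> Complex (inner x y) (- inner (\<i> *\<^sub>C x) y)) F"
    using assms by (intro tendsto_Complex tendsto_intros
        bounded_linear.tendsto[OF bounded_linear_scaleC])
  then show ?thesis
    by (simp add: cinner_eq_Complex[symmetric])
qed

lemma eq_if_cinner_eq_on_dense:
  assumes "closure D = UNIV" and "\<And>z. z \<in> D \<Longrightarrow> cinner x z = cinner y z"
  shows "x = y"
proof -
  have "x - y \<in> closure D"
    by (simp add: assms)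
  then obtain z where z: "\<And>n. z n \<in> D" "z \<longlonglongrightarrow> x - y"
    by (auto simp: closure_sequential)
  have "(\<lambda>n. cinner (x - y) (z n)) \<longlonglongrightarrow> cinner (x - y) (x - y)"
    by (intro tendsto_cinner tendsto_const z)
  moreover have "cinner (x - y) (z n) = 0" for n
    using assms(2)[OF z(1)] by (simp add: cinner_simps)
  ultimately have "cinner (x - y) (x - y) = 0"
    by (simp add: LIMSEQ_const_iff)
  then show ?thesis
    by simp
qed

text \<open>The two halves of a polarized quadratic form depend on the phase \<open>c\<close> in opposite ways, so they
  cannot cancel for all \<open>c\<close>.\<close>

lemma cross_terms_zero:
  assumes "\<And>c :: complex. cnj c * p + c * q = 0"
  shows "p = 0"
  using assms[of 1] assms[of \<i>] by (simp add: complex_eq_iff)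

lemma bounded_clinearD:
  assumes "bounded_clinear T"
  shows "bounded_linear T" "T (x + y) = T x + T y" "T (x - y) = T x - T y"
    "T (c *\<^sub>C x) = c *\<^sub>C T x" "T 0 = 0"
  using assms by (auto simp: bounded_clinear_def linear_simps)

lemma bounded_clinear_ext_dense:
  assumes "bounded_clinear S" and "bounded_clinear T"
    and "closure (cspan B) = UNIV" and "\<And>b. b \<in> B \<Longrightarrow> S b = T b"
  shows "S = T"
proof
  fix x
  have eq: "S y = T y" if "y \<in> cspan B" for y
    using that
    by (induction rule: complex_vector.span_induct_alt)
       (simp_all add: bounded_clinearD(2,4,5)[OF assms(1)] bounded_clinearD(2,4,5)[OF assms(2)] assms(4))
  have "x \<in> closure (cspan B)"
    by (simp add: assms)
  then obtain y where y: "\<And>n. y n \<in> cspan B" "y \<longlonglongrightarrow> x"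
    by (auto simp: closure_sequential)
  have "(\<lambda>n. S (y n)) \<longlonglongrightarrow> S x" "(\<lambda>n. T (y n)) \<longlonglongrightarrow> T x"
    using assms(1,2)[THEN bounded_clinearD(1)] y(2)
    by (auto intro: bounded_linear.tendsto)
  then show "S x = T x"
    using eq[OF y(1)] LIMSEQ_unique by simp
qed


section \<open>Orthogonal projections and spectral measures\<close>

lemma orth_proj_unique:
  assumes P: "orth_proj_onto M P" and "p \<in> M" and "\<And>y. y \<in> M \<Longrightarrow> cinner (x - p) y = 0"
  shows "P x = p"
proof -
  have M: "csubspace M" and Px: "P x \<in> M" "\<And>y. y \<in> M \<Longrightarrow> cinner (x - P x) y = 0"
    using P by (auto simp: orth_proj_onto_def)
  have d: "P x - p \<in> M"
    by (rule complex_vector.subspace_diff[OF M Px(1) assms(2)])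
  have "cinner (P x - p) (P x - p) = cinner (x - p) (P x - p) - cinner (x - P x) (P x - p)"
    by (simp add: cinner_simps)
  then show ?thesis
    using assms(3)[OF d] Px(2)[OF d] by simp
qed

lemma
  assumes P: "orth_proj_onto M P"
  shows orth_proj_add: "P (x + y) = P x + P y"
    and orth_proj_scaleC: "P (c *\<^sub>C x) = c *\<^sub>C P x"
    and orth_proj_fixes: "x \<in> M \<Longrightarrow> P x = x"
    and orth_proj_orthogonal: "(\<And>y. y \<in> M \<Longrightarrow> cinner x y = 0) \<Longrightarrow> P x = 0"
    and orth_proj_cinner: "cinner (P x) y = cinner x (P y)"
proof -
  have M: "csubspace M" and PM: "\<And>x. P x \<in> M"
    and orth: "\<And>x y. y \<in> M \<Longrightarrow> cinner (x - P x) y = 0"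
    using P by (auto simp: orth_proj_onto_def)
  show "P (x + y) = P x + P y"
    using orth[of _ x] orth[of _ y]
    by (intro orth_proj_unique[OF P] complex_vector.subspace_add[OF M] PM)
       (simp add: cinner_simps algebra_simps)
  show "P (c *\<^sub>C x) = c *\<^sub>C P x"
    using orth[of _ x]
    by (intro orth_proj_unique[OF P] complex_vector.subspace_scale[OF M] PM)
       (simp add: cinner_simps algebra_simps)
  show "x \<in> M \<Longrightarrow> P x = x"
    by (rule orth_proj_unique[OF P]) auto
  show "(\<And>y. y \<in> M \<Longrightarrow> cinner x y = 0) \<Longrightarrow> P x = 0"
    by (rule orth_proj_unique[OF P]) (auto simp: complex_vector.subspace_0[OF M])
  have "cinner (P x) (y - P y) = 0"
    using orth[OF PM, of y x] by (subst cinner_commute) simp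
  moreover have "cinner (x - P x) (P y) = 0"
    by (rule orth[OF PM])
  ultimately show "cinner (P x) y = cinner x (P y)"
    by (simp add: cinner_simps)
qed

lemma sets_spectral_distr [simp, measurable_cong]: "sets (spectral_distr E x) = sets borel"
  unfolding spectral_distr_def by (simp add: sets_measure_of_conv sets.sigma_sets_eq[of borel, simplified])

lemma space_spectral_distr [simp]: "space (spectral_distr E x) = UNIV"
  unfolding spectral_distr_def by (simp add: space_measure_of_conv)

context
  fixes E :: "real set \<Rightarrow> 'h::complex_inner \<Rightarrow> 'h"
  assumes E: "spectral_measure E"
begin

lemma spectral_proj: "S \<in> sets borel \<Longrightarrow> \<exists>M. orth_proj_onto M (E S)"
  using E by (auto simp: spectral_measure_def)

lemma spectral_linear:
  assumes "S \<in> sets borel"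
  shows "E S (x + y) = E S x + E S y" "E S (c *\<^sub>C x) = c *\<^sub>C E S x" "E S (x - y) = E S x - E S y"
    "E S 0 = 0"
proof -
  obtain M where M: "orth_proj_onto M (E S)"
    using spectral_proj[OF assms] by blast
  show add: "E S (x + y) = E S x + E S y" for x y
    by (rule orth_proj_add[OF M])
  show "E S (c *\<^sub>C x) = c *\<^sub>C E S x"
    by (rule orth_proj_scaleC[OF M])
  show "E S (x - y) = E S x - E S y"
    using add[of "x - y" y] by simp
  show "E S 0 = 0"
    using add[of 0 0] by simp
qed

lemma spectral_Int: "S \<in> sets borel \<Longrightarrow> S' \<in> sets borel \<Longrightarrow> E S (E S' x) = E (S \<inter> S') x"
  using E by (simp add: spectral_measure_def)

lemma spectral_UNIV: "E UNIV x = x"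
  using E by (simp add: spectral_measure_def)

lemma spectral_empty: "E {} x = 0"
proof -
  have "(\<lambda>n::nat. E {} x) sums E (\<Union>n::nat. {}) x"
    using E unfolding spectral_measure_def
    by (elim conjE) (drule spec[where x="\<lambda>_. {}"], auto simp: disjoint_family_on_def)
  then have "summable (\<lambda>n::nat. E {} x)"
    by (rule sums_summable)
  then show ?thesis
    by (simp add: summable_const_iff)
qed

lemma spectral_cinner: "S \<in> sets borel \<Longrightarrow> cinner (E S x) y = cinner x (E S y)"
  using spectral_proj orth_proj_cinner by blast

lemma spectral_cinner_self: "S \<in> sets borel \<Longrightarrow> cinner (E S x) x = complex_of_real ((norm (E S x))\<^sup>2)"
  using spectral_Int[of S S x] spectral_cinner[of S "E S x" x]
  by (simp add: cinner_self)

lemma spectral_distr_sums: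
  assumes "range F \<subseteq> sets borel" "disjoint_family F"
  shows "(\<lambda>n::nat. (norm (E (F n) x))\<^sup>2) sums (norm (E (\<Union>n. F n) x))\<^sup>2"
proof -
  have [measurable]: "F n \<in> sets borel" for n
    using assms by auto
  have sums: "(\<lambda>n. E (F n) x) sums E (\<Union>n. F n) x"
    using E assms by (simp add: spectral_measure_def)
  have "bounded_linear (\<lambda>y. Re (cinner y x))"
    unfolding Re_cinner by (rule bounded_linear_inner_left)
  from bounded_linear.sums[OF this sums] show ?thesis
    by (simp add: spectral_cinner_self)
qed

lemma emeasure_spectral_distr:
  assumes "S \<in> sets borel"
  shows "emeasure (spectral_distr E x) S = ennreal ((norm (E S x))\<^sup>2)"
proof -
  let ?\<mu> = "\<lambda>S. ennreal (Re (cinner (E S x) x))"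
  have "emeasure (spectral_distr E x) S = ?\<mu> S"
  proof (rule emeasure_measure_of[OF spectral_distr_def])
    show "sets borel \<subseteq> Pow UNIV" by simp
    show "S \<in> sets (spectral_distr E x)" using assms by simp
    show "positive (sets (spectral_distr E x)) ?\<mu>"
      by (simp add: positive_def spectral_empty)
    show "countably_additive (sets (spectral_distr E x)) ?\<mu>"
      unfolding countably_additive_def
    proof (intro allI impI)
      fix F :: "nat \<Rightarrow> real set"
      assume F: "range F \<subseteq> sets (spectral_distr E x)" "disjoint_family F"
      then have Fs: "F n \<in> sets borel" for n by auto
      from F Fs have "(\<lambda>n. Re (cinner (E (F n) x) x)) sums Re (cinner (E (\<Union>n. F n) x) x)"
        using spectral_distr_sums[of F x] by (simp add: spectral_cinner_self sets.countable_UN[of F UNIV borel] image_subset_iff)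
      then show "(\<Sum>n. ?\<mu> (F n)) = ?\<mu> (\<Union>n. F n)"
        by (intro suminf_ennreal_eq) (simp_all add: spectral_cinner_self Fs)
    qed
  qed
  then show ?thesis
    by (simp add: spectral_cinner_self assms)
qed

lemma finite_measure_spectral_distr: "finite_measure (spectral_distr E x)"
  by (rule finite_measureI) (simp add: emeasure_spectral_distr)

lemma spectral_distr_proj:
  assumes S: "S \<in> sets borel"
  shows "spectral_distr E (E S x) = density (spectral_distr E x) (\<lambda>s. ennreal (indicator S s))"
proof (rule measure_eqI)
  fix B assume "B \<in> sets (spectral_distr E (E S x))"
  then have B: "B \<in> sets borel" by simp
  have "emeasure (density (spectral_distr E x) (\<lambda>s. ennreal (indicator S s))) B
      = (\<integral>\<^sup>+ s. indicator (B \<inter> S) s \<partial>spectral_distr E x)"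
    using S B
    by (subst emeasure_density, simp, simp, intro nn_integral_cong) (simp split: split_indicator)
  also have "\<dots> = emeasure (spectral_distr E x) (B \<inter> S)"
    using S B by simp
  finally show "emeasure (spectral_distr E (E S x)) B =
      emeasure (density (spectral_distr E x) (\<lambda>s. ennreal (indicator S s))) B"
    using S B by (simp add: emeasure_spectral_distr spectral_Int)
qed simp

lemma integrable_spectral_distr_proj:
  fixes f :: "real \<Rightarrow> 'b::{banach, second_countable_topology}"
  assumes S: "S \<in> sets borel" and f: "integrable (spectral_distr E x) f"
  shows "integrable (spectral_distr E (E S x)) f"
proof -
  have [measurable]: "f \<in> borel_measurable borel"
    using borel_measurable_integrable[OF f] by simp
  show ?thesis
    unfolding spectral_distr_proj[OF S]
    using S f by (subst integrable_density) (auto intro: integrable_mult_indicator)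
qed

lemma integral_spectral_distr_proj:
  fixes f :: "real \<Rightarrow> 'b::{banach, second_countable_topology}"
  assumes S: "S \<in> sets borel" and f: "f \<in> borel_measurable borel"
  shows "(LINT s|spectral_distr E (E S x). f s) = (LINT s|spectral_distr E x. indicator S s *\<^sub>R f s)"
  unfolding spectral_distr_proj[OF S] using S f by (subst integral_density) auto

lemma spectral_Compl: "S \<in> sets borel \<Longrightarrow> x - E S x = E (- S) x"
proof -
  assume S: "S \<in> sets borel"
  have eq: "(norm x)\<^sup>2 = (norm (E S x))\<^sup>2 + (norm (E (- S) x))\<^sup>2" for x
  proof -
    have "emeasure (spectral_distr E x) (S \<union> - S) =
        emeasure (spectral_distr E x) S + emeasure (spectral_distr E x) (- S)"
      using S by (intro plus_emeasure[symmetric]) auto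
    then show ?thesis
      using S by (simp add: emeasure_spectral_distr spectral_UNIV Compl_partition
          flip: ennreal_plus)
  qed
  \<comment> \<open>Both projections kill the difference of the two sides, whose norm is therefore \<open>0\<close>.\<close>
  have "E S (x - E S x - E (- S) x) = 0" "E (- S) (x - E S x - E (- S) x) = 0"
    using S by (simp_all add: spectral_linear spectral_Int spectral_empty)
  with eq[of "x - E S x - E (- S) x"] show ?thesis
    by simp
qed

lemma integral_spectral_distr_split:
  fixes f :: "real \<Rightarrow> 'b::{banach, second_countable_topology}"
  assumes S: "S \<in> sets borel" and f: "integrable (spectral_distr E x) f"
  shows "(LINT s|spectral_distr E x. f s) =
    (LINT s|spectral_distr E (E S x). f s) + (LINT s|spectral_distr E (E (- S) x). f s)"
proof -
  have [measurable]: "f \<in> borel_measurable borel"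
    using borel_measurable_integrable[OF f] by simp
  have "(LINT s|spectral_distr E (E S x). f s) + (LINT s|spectral_distr E (E (- S) x). f s)
     = (LINT s|spectral_distr E x. indicator S s *\<^sub>R f s) + (LINT s|spectral_distr E x. indicator (- S) s *\<^sub>R f s)"
    using S by (simp add: integral_spectral_distr_proj)
  also have "\<dots> = (LINT s|spectral_distr E x. indicator S s *\<^sub>R f s + indicator (- S) s *\<^sub>R f s)"
    using S f by (intro Bochner_Integration.integral_add[symmetric] integrable_mult_indicator) auto
  also have "\<dots> = (LINT s|spectral_distr E x. f s)"
    by (intro Bochner_Integration.integral_cong) (auto simp: indicator_def)
  finally show ?thesis by simp
qed

lemma integral_spectral_distr_point:
  fixes f :: "real \<Rightarrow> 'b::{banach, second_countable_topology}"
  assumes f: "f \<in> borel_measurable borel" and x: "E {r} x = x"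
  shows "(LINT s|spectral_distr E x. f s) = (norm x)\<^sup>2 *\<^sub>R f r"
proof -
  have "(LINT s|spectral_distr E x. f s) = (LINT s|spectral_distr E x. indicator {r} s *\<^sub>R f s)"
    using integral_spectral_distr_proj[of "{r}" f x] f x by simp
  also have "\<dots> = (LINT s|spectral_distr E x. indicator {r} s *\<^sub>R f r)"
    by (intro Bochner_Integration.integral_cong) (auto simp: indicator_def)
  also have "\<dots> = measure (spectral_distr E x) {r} *\<^sub>R f r"
    by (simp add: emeasure_spectral_distr)
  also have "measure (spectral_distr E x) {r} = (norm x)\<^sup>2"
    by (simp add: measure_def emeasure_spectral_distr x)
  finally show ?thesis .
qed

end


section \<open>Eigenvectors of self-adjoint operators and of their unitary groups\<close>

text \<open>A linear operator whose quadratic form is the integral of \<open>f\<close> against the spectral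
  distributions is reduced by the spectral projections: on \<open>E S x + c \<cdot> E (- S) x'\<close> the quadratic form
  splits into the contributions of \<open>S\<close> and of its complement, so the cross terms vanish.\<close>

lemma quadratic_form_reduces:
  fixes E :: "real set \<Rightarrow> 'h::complex_inner \<Rightarrow> 'h" and f :: "real \<Rightarrow> complex"
  assumes E: "spectral_measure E" and T: "linear_graph T" and dense: "closure (Domain T) = UNIV"
    and form: "\<And>x y. (x, y) \<in> T \<Longrightarrow> cinner y x = (LINT s|spectral_distr E x. f s)"
    and integrable: "\<And>x. x \<in> Domain T \<Longrightarrow> integrable (spectral_distr E x) f"
    and dom: "\<And>x S. x \<in> Domain T \<Longrightarrow> S \<in> sets borel \<Longrightarrow> E S x \<in> Domain T"
    and S: "S \<in> sets borel" and xy: "(x, y) \<in> T"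
  shows "(E S x, E S y) \<in> T"
proof -
  have add: "(a + a', b + b') \<in> T" if "(a, b) \<in> T" "(a', b') \<in> T" for a b a' b'
    using T that by (fastforce simp: linear_graph_def)
  have scale: "(c *\<^sub>C a, c *\<^sub>C b) \<in> T" if "(a, b) \<in> T" for a b c
    using T that by (fastforce simp: linear_graph_def)
  have diff: "(a - a', b - b') \<in> T" if "(a, b) \<in> T" "(a', b') \<in> T" for a b a' b'
    using add[OF that(1) scale[OF that(2), of "- 1"]] by simp
  have off_diagonal: "cinner p (E (- R) w) = 0" if R: "R \<in> sets borel"
    and u: "(E R u, p) \<in> T" and w: "w \<in> Domain T" for R u p w
  proof -
    have "E (- R) w \<in> Domain T"
      using dom[OF w, of "- R"] R by simp
    then obtain q where q: "(E (- R) w, q) \<in> T"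
      by auto
    have "cnj c * cinner p (E (- R) w) + c * cinner q (E R u) = 0" for c
    proof -
      let ?z = "E R u + c *\<^sub>C E (- R) w"
      have z: "(?z, p + c *\<^sub>C q) \<in> T"
        by (intro add scale u q)
      have "E R ?z = E R u" "E (- R) ?z = c *\<^sub>C E (- R) w"
        using R by (simp_all add: spectral_linear[OF E] spectral_Int[OF E] spectral_empty[OF E])
      then have "cinner (p + c *\<^sub>C q) ?z = cinner p (E R u) + cinner (c *\<^sub>C q) (c *\<^sub>C E (- R) w)"
        using integral_spectral_distr_split[OF E R integrable, of ?z] z form[OF z] form[OF u]
          form[OF scale[OF q, of c]]
        by auto
      then show ?thesis
        by (simp add: cinner_simps algebra_simps)
    qed
    then show ?thesis
      by (rule cross_terms_zero)
  qed
  have stays: "E R p = p" if R: "R \<in> sets borel" and u: "(E R u, p) \<in> T" for R u p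
  proof -
    have "E (- R) p = 0"
    proof (rule eq_if_cinner_eq_on_dense[OF dense])
      fix w assume "w \<in> Domain T"
      then show "cinner (E (- R) p) w = cinner 0 w"
        using off_diagonal[OF R u] R by (simp add: spectral_cinner[OF E])
    qed
    then show ?thesis
      using spectral_Compl[OF E R, of p] by simp
  qed
  obtain p where p: "(E S x, p) \<in> T"
    using dom[of x S] xy S by auto
  have "(E (- S) x, y - p) \<in> T"
    using diff[OF xy p] spectral_Compl[OF E S, of x] by simp
  then have "E (- S) (y - p) = y - p"
    using S by (intro stays) simp_all
  then have "E S (y - p) = 0"
    using spectral_Compl[OF E S, of "y - p"] by simp
  then have "E S y = p"
    using stays[OF S p] S by (simp add: spectral_linear[OF E])
  with p show ?thesis
    by simp
qed

text \<open>On the range of \<open>E {r}\<close> the quadratic form is \<open>f r \<parallel>x\<parallel>\<^sup>2\<close>, so by polarization \<open>T\<close> acts there as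
  the scalar \<open>f r\<close>.\<close>

lemma quadratic_form_eigenvector:
  fixes E :: "real set \<Rightarrow> 'h::complex_inner \<Rightarrow> 'h" and f :: "real \<Rightarrow> complex"
  assumes E: "spectral_measure E" and T: "linear_graph T" and dense: "closure (Domain T) = UNIV"
    and form: "\<And>x y. (x, y) \<in> T \<Longrightarrow> cinner y x = (LINT s|spectral_distr E x. f s)"
    and integrable: "\<And>x. x \<in> Domain T \<Longrightarrow> integrable (spectral_distr E x) f"
    and dom: "\<And>x S. x \<in> Domain T \<Longrightarrow> S \<in> sets borel \<Longrightarrow> E S x \<in> Domain T"
    and f: "f \<in> borel_measurable borel"
    and x: "E {r} x = x" and xy: "(x, y) \<in> T"
  shows "y = f r *\<^sub>C x"
proof -
  have add: "(a + a', b + b') \<in> T" if "(a, b) \<in> T" "(a', b') \<in> T" for a b a' b'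
    using T that by (fastforce simp: linear_graph_def)
  have scale: "(c *\<^sub>C a, c *\<^sub>C b) \<in> T" if "(a, b) \<in> T" for a b c
    using T that by (fastforce simp: linear_graph_def)
  have sv: "b = b'" if "(a, b) \<in> T" "(a, b') \<in> T" for a b b'
    using T that by (auto simp: linear_graph_def single_valued_def)
  have "(E {r} x, E {r} y) \<in> T"
    by (rule quadratic_form_reduces[OF E T dense form integrable dom _ xy]) simp_all
  then have Ey: "E {r} y = y"
    unfolding x by (rule sv[OF _ xy])
  have diagonal: "cinner q z = f r * cinner z z" if "(z, q) \<in> T" "E {r} z = z" for z q
    using form[OF that(1)] integral_spectral_distr_point[OF E f that(2)]
    by (simp add: cinner_self scaleR_conv_of_real)
  show ?thesis
  proof (rule eq_if_cinner_eq_on_dense[OF dense])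
    fix w assume w: "w \<in> Domain T"
    then obtain q where q: "(E {r} w, q) \<in> T"
      using dom[OF w, of "{r}"] by auto
    have "cnj c * cinner (y - f r *\<^sub>C x) (E {r} w) + c * cinner (q - f r *\<^sub>C E {r} w) x = 0" for c
    proof -
      have "cinner (y + c *\<^sub>C q) (x + c *\<^sub>C E {r} w)
          = f r * cinner (x + c *\<^sub>C E {r} w) (x + c *\<^sub>C E {r} w)"
        by (intro diagonal add scale xy q)
           (simp add: spectral_linear[OF E] spectral_Int[OF E] x)
      moreover have "cinner q (E {r} w) = f r * cinner (E {r} w) (E {r} w)"
        by (intro diagonal q) (simp add: spectral_Int[OF E])
      ultimately show ?thesis
        using diagonal[OF xy x] by (simp add: cinner_simps algebra_simps)
    qed
    then have "cinner (y - f r *\<^sub>C x) (E {r} w) = 0"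
      by (rule cross_terms_zero)
    then have "cinner (E {r} (y - f r *\<^sub>C x)) w = 0"
      by (simp add: spectral_cinner[OF E])
    then show "cinner y w = cinner (f r *\<^sub>C x) w"
      by (simp add: spectral_linear[OF E] Ey x cinner_simps)
  qed
qed

text \<open>The domain of \<open>\<integral> s dE(s)\<close>, where \<open>s\<^sup>2\<close> is integrable, meets the requirements of the two
  preceding lemmas.\<close>

lemma
  fixes T :: "('h::complex_inner \<times> 'h) set"
  assumes ET: "spectral_resolution E T"
  shows spectral_resolution_measure: "spectral_measure E"
    and spectral_resolution_form: "(x, y) \<in> T \<Longrightarrow> cinner y x = (LINT s|spectral_distr E x. complex_of_real s)"
    and spectral_resolution_integrable:
      "x \<in> Domain T \<Longrightarrow> integrable (spectral_distr E x) complex_of_real"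
    and spectral_resolution_dom: "x \<in> Domain T \<Longrightarrow> S \<in> sets borel \<Longrightarrow> E S x \<in> Domain T"
proof -
  show E: "spectral_measure E"
    using ET by (simp add: spectral_resolution_def)
  have form: "(x, y) \<in> T \<Longrightarrow> cinner y x = complex_of_real (LINT s|spectral_distr E x. s)"
    and D: "Domain T = {x. integrable (spectral_distr E x) (\<lambda>s. s\<^sup>2)}"
    using ET by (auto simp: spectral_resolution_def)
  from form show "(x, y) \<in> T \<Longrightarrow> cinner y x = (LINT s|spectral_distr E x. complex_of_real s)"
    by simp
  show "E S x \<in> Domain T" if "x \<in> Domain T" "S \<in> sets borel"
    using that integrable_spectral_distr_proj[OF E] by (simp add: D)
  show "integrable (spectral_distr E x) complex_of_real" if x: "x \<in> Domain T"
  proof (rule Bochner_Integration.integrable_bound)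
    interpret finite_measure "spectral_distr E x"
      by (rule finite_measure_spectral_distr[OF E])
    show "integrable (spectral_distr E x) (\<lambda>s. 1 + s\<^sup>2)"
      using x by (simp add: D)
    have "\<bar>s\<bar> \<le> 1 + s\<^sup>2" for s :: real
    proof (cases "\<bar>s\<bar> \<le> 1")
      case False
      then have "\<bar>s\<bar> * 1 \<le> \<bar>s\<bar> * \<bar>s\<bar>" by (intro mult_left_mono) auto
      then show ?thesis by (simp add: power2_eq_square)
    next
      case True
      then show ?thesis using zero_le_power2[of s] by linarith
    qed
    then show "AE s in spectral_distr E x. norm (complex_of_real s) \<le> norm (1 + s\<^sup>2)"
      by (simp add: abs_of_nonneg)
  qed simp
qed

text \<open>If \<open>T x = r x\<close>, then the spectral distribution of \<open>x\<close> sits at \<open>r\<close>: for \<open>S\<close> on one side of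
  \<open>r\<close>, the projected vector \<open>E S x\<close> satisfies \<open>\<integral> (s - r) d\<mu> = 0\<close> although the integrand has a strict
  sign on \<open>S\<close>.\<close>

lemma spectral_proj_eigenvector:
  fixes T :: "('h::complex_inner \<times> 'h) set"
  assumes T: "linear_graph T" "closure (Domain T) = UNIV" and ET: "spectral_resolution E T"
    and xy: "(x, r *\<^sub>R x) \<in> T"
  shows "E {r} x = x"
proof -
  note E = spectral_resolution_measure[OF ET]
  \<comment> \<open>The sign \<open>\<sigma>\<close> tells on which side of \<open>r\<close> the set \<open>S\<close> lies.\<close>
  have one_side: "E S x = 0" if S: "S \<in> sets borel" and sign: "\<sigma> \<noteq> 0" "\<And>s. s \<in> S \<Longrightarrow> \<sigma> * (s - r) > 0"
    for S \<sigma>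
  proof -
    let ?\<mu> = "spectral_distr E (E S x)"
    interpret finite_measure ?\<mu>
      by (rule finite_measure_spectral_distr[OF E])
    have "(E S x, E S (r *\<^sub>R x)) \<in> T"
      using quadratic_form_reduces[OF E T spectral_resolution_form[OF ET]
          spectral_resolution_integrable[OF ET] spectral_resolution_dom[OF ET] S xy] .
    then have Tx: "(E S x, r *\<^sub>R E S x) \<in> T"
      using S by (simp add: scaleR_eq_scaleC spectral_linear[OF E])
    have int: "integrable ?\<mu> (\<lambda>s. s)"
      using spectral_resolution_integrable[OF ET, of "E S x"] Tx
      by (auto simp: complex_of_real_integrable_eq)
    have \<mu>: "measure ?\<mu> UNIV = (norm (E S x))\<^sup>2"
      by (simp add: measure_def emeasure_spectral_distr[OF E] spectral_UNIV[OF E])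
    have "complex_of_real (LINT s|?\<mu>. s) = complex_of_real (r * (norm (E S x))\<^sup>2)"
      using spectral_resolution_form[OF ET Tx] by (simp add: cinner_scaleR_left cinner_self)
    then have "(LINT s|?\<mu>. s) = r * (norm (E S x))\<^sup>2"
      unfolding of_real_eq_iff .
    then have zero: "(LINT s|?\<mu>. \<sigma> * (s - r)) = 0"
      using int by (simp add: \<mu>)
    have "emeasure ?\<mu> (- S) = 0"
      using S by (simp add: emeasure_spectral_distr[OF E] spectral_Int[OF E] spectral_empty[OF E])
    then have AE_S: "AE s in ?\<mu>. s \<in> S"
      using S by (intro AE_I[where N="- S"]) auto
    then have "AE s in ?\<mu>. 0 \<le> \<sigma> * (s - r)"
      by eventually_elim (use sign in \<open>simp add: less_imp_le\<close>)
    then have "AE s in ?\<mu>. \<sigma> * (s - r) = 0"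
      using int zero by (subst (asm) integral_nonneg_eq_0_iff_AE) auto
    with AE_S have "AE s in ?\<mu>. False"
      by eventually_elim (use sign in fastforce)
    then have "emeasure ?\<mu> (space ?\<mu>) = 0"
      by (subst (asm) AE_iff_measurable[of "space ?\<mu>"]) auto
    then have "(norm (E S x))\<^sup>2 = 0"
      by (simp add: emeasure_spectral_distr[OF E] spectral_UNIV[OF E])
    then show ?thesis
      by simp
  qed
  have "E {r<..} x = 0" "E {..<r} x = 0"
    by (rule one_side[where \<sigma>=1]; simp) (rule one_side[where \<sigma>="- 1"]; simp)
  moreover have "- {r} = {r<..} \<union> {..<r}"
    by auto
  moreover have "E ({r<..} \<union> {..<r}) x = E {r<..} x + E {..<r} x"
  proof -
    have "E ({r<..} \<union> {..<r}) x - E {r<..} (E ({r<..} \<union> {..<r}) x)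
        = E (- {r<..}) (E ({r<..} \<union> {..<r}) x)"
      by (rule spectral_Compl[OF E]) simp
    moreover have "{r<..} \<inter> ({r<..} \<union> {..<r}) = {r<..}" "- {r<..} \<inter> ({r<..} \<union> {..<r}) = {..<r}"
      by auto
    ultimately show ?thesis
      by (simp add: spectral_Int[OF E] algebra_simps)
  qed
  ultimately show ?thesis
    using spectral_Compl[OF E, of "{r}" x] by simp
qed

lemma self_adjointD:
  assumes "self_adjoint T"
  shows "linear_graph T" "closure (Domain T) = UNIV" "adjoint_graph T = T"
  using assms by (auto simp: self_adjoint_def)

text \<open>The spectral distribution of an eigenvector of \<open>A\<close> is a point mass, and on such vectors
  \<open>U t = \<integral> exp (\<i> t s) dE(s)\<close>, seen as an everywhere defined operator, is a scalar.\<close>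

lemma exp_group_eigenvector:
  assumes A: "self_adjoint A" and U: "is_exp_group A U" and x: "(x, r *\<^sub>R x) \<in> A"
  shows "U t x = cis (t * r) *\<^sub>C x"
proof -
  obtain E where ET: "spectral_resolution E A" and bc: "\<And>t. bounded_clinear (U t)"
    and form: "\<And>t x. cinner (U t x) x = (LINT s|spectral_distr E x. exp (\<i> * complex_of_real (t * s)))"
    using U by (auto simp: is_exp_group_def)
  note E = spectral_resolution_measure[OF ET]
  let ?T = "{(x, U t x) | x. True}"
  have "linear_graph ?T"
    using bc[of t] by (auto simp: linear_graph_def single_valued_def bounded_clinearD)
  moreover have "closure (Domain ?T) = UNIV"
    by (auto simp: Domain_unfold)
  ultimately have "U t x = exp (\<i> * complex_of_real (t * r)) *\<^sub>C x"
  proof (rule quadratic_form_eigenvector[OF E, where f="\<lambda>s. exp (\<i> * complex_of_real (t * s))" and r=r])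
    show "integrable (spectral_distr E z) (\<lambda>s. exp (\<i> * complex_of_real (t * s)))" for z
    proof -
      interpret finite_measure "spectral_distr E z"
        by (rule finite_measure_spectral_distr[OF E])
      show ?thesis
        by (rule integrable_const_bound[where B=1]) (auto simp: norm_exp_i_times)
    qed
    show "E {r} x = x"
      by (rule spectral_proj_eigenvector[OF self_adjointD(1,2)[OF A] ET x])
  qed (auto simp: form)
  then show ?thesis
    by (simp add: cis_conv_exp)
qed

text \<open>Conversely, \<open>V t x = exp (i t r) x\<close> for all \<open>t\<close> gives \<open>\<integral> (1 - cos (t (s - r))) d\<mu> = 0\<close>; taking
  \<open>t = 1 / n\<close> for all \<open>n\<close>, the spectral distribution of \<open>x\<close> sits at \<open>r\<close>, so \<open>x\<close> lies in the domain.\<close>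

lemma exp_group_eigenvector_generator:
  assumes T: "self_adjoint T" and V: "is_exp_group T V"
    and x: "\<And>t. V t x = cis (t * r) *\<^sub>C x"
  shows "(x, r *\<^sub>R x) \<in> T"
proof -
  obtain E where ET: "spectral_resolution E T"
    and form: "\<And>t x. cinner (V t x) x = (LINT s|spectral_distr E x. exp (\<i> * complex_of_real (t * s)))"
    using V by (auto simp: is_exp_group_def)
  note E = spectral_resolution_measure[OF ET]
  let ?\<mu> = "spectral_distr E x"
  interpret finite_measure ?\<mu>
    by (rule finite_measure_spectral_distr[OF E])
  have \<mu>: "measure ?\<mu> UNIV = (norm x)\<^sup>2"
    by (simp add: measure_def emeasure_spectral_distr[OF E] spectral_UNIV[OF E])
  have AE_cos: "AE s in ?\<mu>. cos (t * (s - r)) = 1" for t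
  proof -
    have int: "integrable ?\<mu> (\<lambda>s. cis (t * (s - r)))"
      by (rule integrable_const_bound[where B=1]) (auto simp: cis_conv_exp)
    have "(LINT s|?\<mu>. cis (t * (s - r))) = (LINT s|?\<mu>. cis (- (t * r)) * exp (\<i> * complex_of_real (t * s)))"
      unfolding cis_conv_exp[symmetric] cis_mult
      by (intro Bochner_Integration.integral_cong) (simp_all add: right_diff_distrib)
    also have "\<dots> = cis (- (t * r)) * cinner (V t x) x"
      by (simp add: form)
    also have "\<dots> = complex_of_real ((norm x)\<^sup>2)"
      unfolding x cinner_scaleC_left cinner_self mult.assoc[symmetric] cis_mult by simp
    finally have "Re (LINT s|?\<mu>. cis (t * (s - r))) = (norm x)\<^sup>2"
      by simp
    then have "(LINT s|?\<mu>. cos (t * (s - r))) = (norm x)\<^sup>2"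
      using integral_Re[OF int] by simp
    moreover have intc: "integrable ?\<mu> (\<lambda>s. cos (t * (s - r)))"
      by (rule integrable_const_bound[where B=1]) auto
    ultimately have "(LINT s|?\<mu>. 1 - cos (t * (s - r))) = 0"
      by (simp add: \<mu>)
    then have "AE s in ?\<mu>. 1 - cos (t * (s - r)) = 0"
      using intc by (subst (asm) integral_nonneg_eq_0_iff_AE) auto
    then show ?thesis
      by simp
  qed
  then have "AE s in ?\<mu>. \<forall>n::nat. cos ((s - r) / real (Suc n)) = 1"
    unfolding AE_all_countable using AE_cos[of "1 / real (Suc n)" for n] by simp
  then have AE_r: "AE s in ?\<mu>. s = r"
  proof eventually_elim
    case (elim s)
    obtain n where n: "\<bar>s - r\<bar> < real n"
      using reals_Archimedean2 by blast
    let ?y = "(s - r) / real (Suc n)"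
    have "\<bar>?y\<bar> < 1"
      using n by (simp add: divide_simps)
    then have "\<bar>?y\<bar> \<le> pi"
      using pi_gt3 by linarith
    moreover have "cos \<bar>?y\<bar> = 1"
      using elim unfolding cos_abs_real by blast
    ultimately have "\<not> 0 < \<bar>?y\<bar>"
      using cos_monotone_0_pi[of 0 "\<bar>?y\<bar>"] by auto
    then have "?y = 0"
      by (simp only: zero_less_abs_iff not_not)
    then show ?case
      by simp
  qed
  have "emeasure ?\<mu> (- {r}) = 0"
    using AE_r by (subst (asm) AE_iff_measurable[of "- {r}"]) auto
  then have Ex: "E {r} x = x"
    using spectral_Compl[OF E, of "{r}" x] by (simp add: emeasure_spectral_distr[OF E])
  have "integrable ?\<mu> (\<lambda>s. s\<^sup>2)"
    by (rule integrable_const_bound[where B="r\<^sup>2"]) (use AE_r in \<open>auto elim!: eventually_mono\<close>)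
  then obtain y where y: "(x, y) \<in> T"
    using ET by (auto simp: spectral_resolution_def)
  have "y = complex_of_real r *\<^sub>C x"
    by (rule quadratic_form_eigenvector[OF E self_adjointD(1,2)[OF T] spectral_resolution_form[OF ET]
          spectral_resolution_integrable[OF ET] spectral_resolution_dom[OF ET] _ Ex y]) simp_all
  with y show ?thesis
    by (simp add: scaleR_eq_scaleC)
qed


lemma closed_self_adjoint:
  assumes "self_adjoint T"
  shows "closed T"
  unfolding closed_sequential_limits
proof (intro allI impI, elim conjE)
  fix p l assume p: "\<forall>n. p n \<in> T" and lim: "p \<longlonglongrightarrow> l"
  have "cinner w (fst l) = cinner x (snd l)" if "(x, w) \<in> T" for x w
  proof -
    have "(fst (p n), snd (p n)) \<in> adjoint_graph T" for n
      using p self_adjointD(3)[OF assms] by simp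
    then have "cinner w (fst (p n)) = cinner x (snd (p n))" for n
      using that unfolding adjoint_graph_def by fast
    moreover have "(\<lambda>n. cinner w (fst (p n))) \<longlonglongrightarrow> cinner w (fst l)"
      "(\<lambda>n. cinner x (snd (p n))) \<longlonglongrightarrow> cinner x (snd l)"
      by (intro tendsto_cinner tendsto_const tendsto_fst tendsto_snd lim)+
    ultimately show ?thesis
      by (simp add: LIMSEQ_unique)
  qed
  then have "l \<in> adjoint_graph T"
    by (auto simp: adjoint_graph_def)
  then show "l \<in> T"
    by (simp add: self_adjointD(3)[OF assms])
qed

text \<open>By symmetry \<open>\<parallel>T x + \<i> x\<parallel>\<^sup>2 = \<parallel>T x\<parallel>\<^sup>2 + \<parallel>x\<parallel>\<^sup>2\<close>, so convergence of \<open>T x\<^sub>n + \<i> x\<^sub>n\<close> forces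
  convergence in the graph.\<close>

lemma closure_eq_self_adjoint:
  fixes T :: "('h::complex_inner \<times> 'h) set"
  assumes T: "self_adjoint T" and G: "G \<subseteq> T"
    and dense: "closure ((\<lambda>(x, y). y + \<i> *\<^sub>C x) ` G) = UNIV"
  shows "closure G = T"
proof
  show "closure G \<subseteq> T"
    by (rule closure_minimal[OF G closed_self_adjoint[OF T]])
  have pythagoras: "(norm (y + \<i> *\<^sub>C x))\<^sup>2 = (norm y)\<^sup>2 + (norm x)\<^sup>2" if xy: "(x, y) \<in> T" for x y
  proof -
    have "(x, y) \<in> adjoint_graph T"
      using xy by (simp add: self_adjointD(3)[OF T])
    then have sym: "cinner y x = cinner x y"
      using xy unfolding adjoint_graph_def by fast
    have "complex_of_real ((norm (y + \<i> *\<^sub>C x))\<^sup>2) = complex_of_real ((norm y)\<^sup>2 + (norm x)\<^sup>2)"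
      unfolding cinner_self[symmetric] of_real_add by (simp add: cinner_simps sym algebra_simps)
    then show ?thesis
      unfolding of_real_eq_iff .
  qed
  have T_diff: "(x - x', y - y') \<in> T" if "(x, y) \<in> T" "(x', y') \<in> T" for x y x' y'
  proof -
    have "(- 1 *\<^sub>C x', - 1 *\<^sub>C y') \<in> T"
      using self_adjointD(1)[OF T] that(2) unfolding linear_graph_def by fast
    then have "(x + - 1 *\<^sub>C x', y + - 1 *\<^sub>C y') \<in> T"
      using self_adjointD(1)[OF T] that(1) unfolding linear_graph_def by fast
    then show ?thesis
      by simp
  qed
  show "T \<subseteq> closure G"
  proof clarify
    fix x y assume xy: "(x, y) \<in> T"
    have "y + \<i> *\<^sub>C x \<in> closure ((\<lambda>(x, y). y + \<i> *\<^sub>C x) ` G)"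
      by (simp add: dense)
    then obtain z where z: "\<And>n. z n \<in> (\<lambda>(x, y). y + \<i> *\<^sub>C x) ` G" and lim: "z \<longlonglongrightarrow> y + \<i> *\<^sub>C x"
      by (auto simp: closure_sequential)
    have "\<exists>p. p \<in> G \<and> z n = snd p + \<i> *\<^sub>C fst p" for n
      using z[of n] by auto
    then obtain p where p: "\<And>n. p n \<in> G" "\<And>n. z n = snd (p n) + \<i> *\<^sub>C fst (p n)"
      by metis
    have bound: "norm (fst (p n) - x) \<le> norm (z n - (y + \<i> *\<^sub>C x))"
      "norm (snd (p n) - y) \<le> norm (z n - (y + \<i> *\<^sub>C x))" for n
    proof -
      have "(fst (p n) - x, snd (p n) - y) \<in> T"
        using T_diff[OF _ xy, of "fst (p n)" "snd (p n)"] G p(1)[of n] by auto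
      from pythagoras[OF this]
      have "(norm (z n - (y + \<i> *\<^sub>C x)))\<^sup>2 = (norm (snd (p n) - y))\<^sup>2 + (norm (fst (p n) - x))\<^sup>2"
        by (simp add: p(2) scaleC_diff_right algebra_simps)
      then show "norm (fst (p n) - x) \<le> norm (z n - (y + \<i> *\<^sub>C x))"
        "norm (snd (p n) - y) \<le> norm (z n - (y + \<i> *\<^sub>C x))"
        by (simp_all add: power2_le_imp_le)
    qed
    have "(\<lambda>n. norm (z n - (y + \<i> *\<^sub>C x))) \<longlonglongrightarrow> 0"
      using lim by (simp add: LIM_zero_iff tendsto_norm_zero_iff)
    then have "(\<lambda>n. norm (fst (p n) - x)) \<longlonglongrightarrow> 0" "(\<lambda>n. norm (snd (p n) - y)) \<longlonglongrightarrow> 0"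
      by (rule Lim_null_comparison[rotated]; simp add: bound)+
    then have "(\<lambda>n. fst (p n)) \<longlonglongrightarrow> x" "(\<lambda>n. snd (p n)) \<longlonglongrightarrow> y"
      by (simp_all add: LIM_zero_iff tendsto_norm_zero_iff)
    then have "(\<lambda>n. (fst (p n), snd (p n))) \<longlonglongrightarrow> (x, y)"
      by (rule tendsto_Pair)
    then show "(x, y) \<in> closure G"
      using p(1) by (auto simp: closure_sequential)
  qed
qed

section \<open>States on unital C*-algebras\<close>

context unital_cstar_algebra
begin

lemma cscale_zero [simp]: "x \<in> carrier A \<Longrightarrow> cscale A 0 x = \<zero>"
  by (metis cnorm_cscale cnorm_eq_0 cscale_closed mult_zero_left norm_zero)

lemma cscale_minus_one: "x \<in> carrier A \<Longrightarrow> cscale A (- 1) x = \<ominus> x"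
  by (rule minus_equality[symmetric])
     (metis add.right_neutral add.left_inverse cscale_add_left cscale_one cscale_zero, simp_all add: cscale_closed)

lemma minus_eq_cscale: "\<lbrakk>x \<in> carrier A; y \<in> carrier A\<rbrakk> \<Longrightarrow> x \<ominus> y = x \<oplus> cscale A (- 1) y"
  by (simp add: cscale_minus_one a_minus_def)

lemma cscale_of_zero [simp]: "cscale A c \<zero> = \<zero>"
  by (metis cnorm_cscale cnorm_eq_0 cscale_closed mult_zero_right zero_closed)

lemma cscale_minus: "x \<in> carrier A \<Longrightarrow> cscale A c (\<ominus> x) = \<ominus> cscale A c x"
  by (simp add: cscale_minus_one[symmetric] cscale_cscale cscale_closed mult.commute)

lemma cscale_uminus: "x \<in> carrier A \<Longrightarrow> cscale A (- c) x = \<ominus> cscale A c x"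
  by (simp add: cscale_minus_one[symmetric] cscale_cscale cscale_closed)

lemma cscale_diff_right:
  "\<lbrakk>x \<in> carrier A; y \<in> carrier A\<rbrakk> \<Longrightarrow> cscale A c (x \<ominus> y) = cscale A c x \<ominus> cscale A c y"
  by (simp add: a_minus_def cscale_add_right cscale_minus)

lemma cscale_half_double: "x \<in> carrier A \<Longrightarrow> cscale A (1/2) (x \<oplus> x) = x"
  by (simp add: cscale_add_right cscale_add_left[symmetric] cscale_one)

lemma star_zero [simp]: "star A \<zero> = \<zero>"
  using star_cscale[of \<zero> 0] by (simp add: star_closed)

lemma star_one [simp]: "star A \<one> = \<one>"
  by (metis l_one one_closed r_one star_closed star_mult star_star)

lemma star_minus: "x \<in> carrier A \<Longrightarrow> star A (\<ominus> x) = \<ominus> star A x"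
  by (simp add: cscale_minus_one[symmetric] star_cscale star_closed)

lemma star_diff: "\<lbrakk>x \<in> carrier A; y \<in> carrier A\<rbrakk> \<Longrightarrow> star A (x \<ominus> y) = star A x \<ominus> star A y"
  by (simp add: a_minus_def star_add star_minus star_closed)

lemma cnorm_zero [simp]: "cnorm A \<zero> = 0"
  by (simp add: cnorm_eq_0)

lemma cnorm_minus: "x \<in> carrier A \<Longrightarrow> cnorm A (\<ominus> x) = cnorm A x"
  by (simp add: cscale_minus_one[symmetric] cnorm_cscale)

lemma cnorm_diff_commute: "\<lbrakk>x \<in> carrier A; y \<in> carrier A\<rbrakk> \<Longrightarrow> cnorm A (x \<ominus> y) = cnorm A (y \<ominus> x)"
  using cnorm_minus[of "x \<ominus> y"] by (simp add: a_minus_def minus_add a_comm)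

lemma diff_add_diff: "\<lbrakk>x \<in> carrier A; y \<in> carrier A; z \<in> carrier A\<rbrakk> \<Longrightarrow> (x \<ominus> y) \<oplus> (y \<ominus> z) = x \<ominus> z"
  by algebra

lemma cnorm_diff_triangle:
  "\<lbrakk>x \<in> carrier A; y \<in> carrier A; z \<in> carrier A\<rbrakk> \<Longrightarrow> cnorm A (x \<ominus> z) \<le> cnorm A (x \<ominus> y) + cnorm A (y \<ominus> z)"
  using cnorm_triangle[of "x \<ominus> y" "y \<ominus> z"] by (simp add: diff_add_diff)

lemma diff_eq_zero_iff: "\<lbrakk>x \<in> carrier A; y \<in> carrier A\<rbrakk> \<Longrightarrow> x \<ominus> y = \<zero> \<longleftrightarrow> x = y"
  by (metis a_minus_def add.inv_closed minus_equality minus_minus r_neg)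

lemma eq_if_cnorm_diff_small:
  assumes "x \<in> carrier A" "y \<in> carrier A" and "\<And>e. e > 0 \<Longrightarrow> cnorm A (x \<ominus> y) \<le> e"
  shows "x = y"
proof -
  have "cnorm A (x \<ominus> y) \<le> 0"
    by (rule field_le_epsilon) (use assms(3) in simp)
  then show ?thesis
    using assms(1,2) cnorm_nonneg[of "x \<ominus> y"] cnorm_eq_0[of "x \<ominus> y"] diff_eq_zero_iff by force
qed

lemma cnorm_star: 
  assumes "x \<in> carrier A"
  shows "cnorm A (star A x) = cnorm A x"
proof -
  have le: "cnorm A x \<le> cnorm A (star A x)" if x: "x \<in> carrier A" for x
  proof (cases "cnorm A x = 0")
    case True
    then show ?thesis by (simp add: cnorm_nonneg star_closed x)
  next
    case False
    have "cnorm A x * cnorm A x \<le> cnorm A (star A x) * cnorm A x"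
      using cstar_identity[OF x] cnorm_mult[OF star_closed[OF x] x] by (simp add: power2_eq_square)
    then show ?thesis
      using False cnorm_nonneg[OF x] by (simp add: mult_le_cancel_right)
  qed
  show ?thesis
    using le[OF assms] le[OF star_closed[OF assms]] star_star[OF assms] by simp
qed

text \<open>Every self-adjoint element close enough to \<open>1\<close> is the square of a self-adjoint element:
  \<open>w = (h + w\<^sup>2) / 2\<close> says \<open>(1 - w)\<^sup>2 = 1 - h\<close>, and \<open>w \<mapsto> (h + w\<^sup>2) / 2\<close> is a contraction with
  factor \<open>\<parallel>h\<parallel>\<close> of the ball of radius \<open>\<parallel>h\<parallel>\<close>.\<close>

lemma selfadjoint_sqrt_near_one:
  assumes h: "h \<in> carrier A" and sa: "star A h = h" and h1: "cnorm A h < 1"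
  shows "\<exists>z\<in>carrier A. star A z \<otimes> z = \<one> \<ominus> h"
proof -
  define r where "r = cnorm A h"
  have r: "0 \<le> r" "r < 1"
    using h1 cnorm_nonneg[OF h] by (simp_all add: r_def)
  define g where "g = (\<lambda>w. cscale A (1/2) (h \<oplus> w \<otimes> w))"
  have g_closed: "g w \<in> carrier A" if "w \<in> carrier A" for w
    using that h by (simp add: g_def cscale_closed)
  have g_star: "star A (g w) = g w" if "w \<in> carrier A" "star A w = w" for w
    using that h sa by (simp add: g_def star_cscale star_add star_mult)
  have g_norm: "cnorm A (g w) \<le> r" if w: "w \<in> carrier A" "cnorm A w \<le> r" for w
  proof -
    have "cnorm A (w \<otimes> w) \<le> cnorm A w * cnorm A w"
      using w by (simp add: cnorm_mult)
    also have "\<dots> \<le> r * 1"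
      using w r cnorm_nonneg by (intro mult_mono) auto
    finally have "cnorm A (h \<oplus> w \<otimes> w) \<le> r + r"
      using cnorm_triangle[OF h, of "w \<otimes> w"] w by (simp add: r_def)
    then show ?thesis
      using h w by (simp add: g_def cnorm_cscale)
  qed
  have g_contr: "cnorm A (g w \<ominus> g u) \<le> r * cnorm A (w \<ominus> u)"
    if w: "w \<in> carrier A" "cnorm A w \<le> r" and u: "u \<in> carrier A" "cnorm A u \<le> r" for w u
  proof -
    have "(h \<oplus> w \<otimes> w) \<ominus> (h \<oplus> u \<otimes> u) = w \<otimes> (w \<ominus> u) \<oplus> (w \<ominus> u) \<otimes> u"
      using h w(1) u(1) by algebra
    then have "g w \<ominus> g u = cscale A (1/2) (w \<otimes> (w \<ominus> u) \<oplus> (w \<ominus> u) \<otimes> u)"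
      using h w u by (simp add: g_def cscale_diff_right[symmetric])
    then have "cnorm A (g w \<ominus> g u) = 1/2 * cnorm A (w \<otimes> (w \<ominus> u) \<oplus> (w \<ominus> u) \<otimes> u)"
      using w u by (simp add: cnorm_cscale)
    also have "cnorm A (w \<otimes> (w \<ominus> u) \<oplus> (w \<ominus> u) \<otimes> u) \<le> cnorm A w * cnorm A (w \<ominus> u) + cnorm A (w \<ominus> u) * cnorm A u"
      using w u by (intro order_trans[OF cnorm_triangle] add_mono cnorm_mult) auto
    also have "\<dots> \<le> r * cnorm A (w \<ominus> u) + cnorm A (w \<ominus> u) * r"
      using w u by (intro add_mono mult_right_mono mult_left_mono cnorm_nonneg) auto
    finally show ?thesis
      by simp
  qed
  define w where "w = (\<lambda>n. (g ^^ n) \<zero>)"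
  have w0: "w 0 = \<zero>" and wS: "w (Suc n) = g (w n)" for n
    by (simp_all add: w_def)
  have "w n \<in> carrier A \<and> star A (w n) = w n \<and> cnorm A (w n) \<le> r" for n
    by (induction n) (simp_all add: w0 wS g_closed g_star g_norm r)
  then have w: "w n \<in> carrier A" "star A (w n) = w n" "cnorm A (w n) \<le> r" for n
    by simp_all
  have step: "cnorm A (w (Suc n) \<ominus> w n) \<le> r ^ n" for n
  proof (induction n)
    case 0
    have "w 1 \<ominus> w 0 = w 1"
      using w(1)[of 1] by (simp add: w0 a_minus_def)
    then show ?case
      using w(3)[of 1] r by simp
  next
    case (Suc n)
    have "cnorm A (w (Suc (Suc n)) \<ominus> w (Suc n)) \<le> r * cnorm A (w (Suc n) \<ominus> w n)"
      using g_contr[OF w(1,3) w(1,3), of "Suc n" n] by (simp only: wS)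
    also have "\<dots> \<le> r * r ^ n"
      by (rule mult_left_mono[OF Suc r(1)])
    finally show ?case by simp
  qed
  have tail: "cnorm A (w (n + k) \<ominus> w n) \<le> r ^ n / (1 - r)" for n k
  proof -
    have "cnorm A (w (n + k) \<ominus> w n) \<le> r ^ n * (\<Sum>i<k. r ^ i)"
    proof (induction k)
      case 0
      then show ?case using w(1)[of n] by (simp add: a_minus_def r_neg)
    next
      case (Suc k)
      then show ?case
        using cnorm_diff_triangle[of "w (Suc (n + k))" "w (n + k)" "w n"] w(1) step[of "n + k"]
        by (simp add: algebra_simps power_add)
    qed
    also have "(\<Sum>i<k. r ^ i) \<le> 1 / (1 - r)"
      using r by (simp add: sum_gp_strict divide_right_mono)
    finally show ?thesis
      using r by (simp add: mult_left_mono)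
  qed
  have lim0: "(\<lambda>n. 2 * (r ^ n / (1 - r))) \<longlonglongrightarrow> 0"
    using r by (intro tendsto_eq_intros LIMSEQ_realpow_zero) auto
  have "\<exists>x\<in>carrier A. (\<lambda>n. cnorm A (w n \<ominus> x)) \<longlonglongrightarrow> 0"
  proof (rule complete, goal_cases)
    case 1
    show ?case
      using w by auto
  next
    case 2
    show ?case
    proof (intro allI impI)
      fix e :: real assume "e > 0"
      with lim0 obtain N where N: "2 * (r ^ N / (1 - r)) < e"
        by (auto dest!: order_tendstoD(2) eventually_happens)
      have "cnorm A (w m \<ominus> w n) < e" if mn: "m \<ge> N" "n \<ge> N" for m n
      proof -
        have "cnorm A (w m \<ominus> w N) \<le> r ^ N / (1 - r)" "cnorm A (w n \<ominus> w N) \<le> r ^ N / (1 - r)"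
          using tail[of N "m - N"] tail[of N "n - N"] mn by simp_all
        then show ?thesis
          using cnorm_diff_triangle[of "w m" "w N" "w n"] w(1) N
          by (simp add: cnorm_diff_commute[of "w N"])
      qed
      then show "\<exists>N. \<forall>m\<ge>N. \<forall>n\<ge>N. cnorm A (w m \<ominus> w n) < e"
        by blast
    qed
  qed
  then obtain x where x: "x \<in> carrier A" and lim: "(\<lambda>n. cnorm A (w n \<ominus> x)) \<longlonglongrightarrow> 0"
    by blast
  have close: "\<exists>n. cnorm A (w n \<ominus> x) < e \<and> cnorm A (w (Suc n) \<ominus> x) < e" if "e > 0" for e
    using eventually_happens[OF eventually_conj[OF order_tendstoD(2)[OF lim that]
        order_tendstoD(2)[OF LIMSEQ_Suc[OF lim] that]]] by auto
  have x_star: "star A x = x"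
  proof (rule eq_if_cnorm_diff_small)
    fix e :: real assume "e > 0"
    then obtain n where n: "cnorm A (w n \<ominus> x) < e/2"
      using close[of "e/2"] by auto
    have "star A (w n \<ominus> x) = w n \<ominus> star A x"
      using w x by (simp add: star_diff)
    then have "cnorm A (w n \<ominus> star A x) = cnorm A (w n \<ominus> x)"
      using cnorm_star[of "w n \<ominus> x"] w x by simp
    then show "cnorm A (star A x \<ominus> x) \<le> e"
      using n cnorm_diff_triangle[of "star A x" "w n" x] w x
      by (simp add: star_closed cnorm_diff_commute[of "star A x"])
  qed (simp_all add: star_closed x)
  have x_norm: "cnorm A x \<le> r"
  proof (rule field_le_epsilon)
    fix e :: real assume "e > 0"
    then obtain n where n: "cnorm A (w n \<ominus> x) < e"
      using close[of e] by auto
    have "x = w n \<ominus> (w n \<ominus> x)"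
      using w(1)[of n] x by algebra
    then have "cnorm A x \<le> cnorm A (w n) + cnorm A (w n \<ominus> x)"
      using cnorm_triangle[of "w n" "\<ominus> (w n \<ominus> x)"] w x by (simp add: cnorm_minus a_minus_def)
    then show "cnorm A x \<le> r + e"
      using w(3)[of n] n by simp
  qed
  have x_fix: "g x = x"
  proof (rule eq_if_cnorm_diff_small)
    fix e :: real assume "e > 0"
    then obtain n where n: "cnorm A (w n \<ominus> x) < e/2" "cnorm A (w (Suc n) \<ominus> x) < e/2"
      using close[of "e/2"] by auto
    have "cnorm A (g x \<ominus> w (Suc n)) \<le> r * cnorm A (x \<ominus> w n)"
      unfolding wS using g_contr x x_norm w by blast
    also have "\<dots> \<le> 1 * cnorm A (x \<ominus> w n)"
      using r x w by (intro mult_right_mono cnorm_nonneg) auto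
    finally show "cnorm A (g x \<ominus> x) \<le> e"
      using n cnorm_diff_triangle[of "g x" "w (Suc n)" x] w x
      by (simp add: g_closed cnorm_diff_commute[of x])
  qed (simp_all add: g_closed x)
  have double: "x \<oplus> x = h \<oplus> x \<otimes> x"
  proof -
    have "x \<oplus> x = cscale A (1/2) (h \<oplus> x \<otimes> x) \<oplus> cscale A (1/2) (h \<oplus> x \<otimes> x)"
      using x_fix by (simp add: g_def)
    also have "\<dots> = h \<oplus> x \<otimes> x"
      using h x by (simp add: cscale_add_left[symmetric] cscale_one)
    finally show ?thesis .
  qed
  have "(\<one> \<ominus> x) \<otimes> (\<one> \<ominus> x) = \<one> \<ominus> (x \<oplus> x) \<oplus> x \<otimes> x"
    using x by (simp add: a_minus_def l_distr r_distr l_minus r_minus minus_add a_ac)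
  also have "\<dots> = \<one> \<ominus> h"
    unfolding double using h x by algebra
  finally have "star A (\<one> \<ominus> x) \<otimes> (\<one> \<ominus> x) = \<one> \<ominus> h"
    using x x_star by (simp add: star_diff)
  then show ?thesis
    using x by blast
qed


text \<open>The squared norm of the vector of \<open>x\<close> in the GNS space of \<open>\<phi>\<close>.\<close>

definition sq_norm :: "('a \<Rightarrow> complex) \<Rightarrow> 'a \<Rightarrow> real" where
  "sq_norm \<phi> x = Re (\<phi> (star A x \<otimes> x))"

context
  fixes \<phi> :: "'a \<Rightarrow> complex"
  assumes state: "is_state A \<phi>"
begin

lemma state_add: "\<lbrakk>x \<in> carrier A; y \<in> carrier A\<rbrakk> \<Longrightarrow> \<phi> (x \<oplus> y) = \<phi> x + \<phi> y"
  and state_cscale: "x \<in> carrier A \<Longrightarrow> \<phi> (cscale A c x) = c * \<phi> x"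
  and state_one: "\<phi> \<one> = 1"
  using state by (simp_all add: is_state_def)

lemma state_diff: "\<lbrakk>x \<in> carrier A; y \<in> carrier A\<rbrakk> \<Longrightarrow> \<phi> (x \<ominus> y) = \<phi> x - \<phi> y"
  by (simp add: minus_eq_cscale state_add state_cscale cscale_closed)

lemma state_positive: "x \<in> carrier A \<Longrightarrow> \<phi> (star A x \<otimes> x) = complex_of_real (sq_norm \<phi> x)"
  and sq_norm_nonneg: "x \<in> carrier A \<Longrightarrow> 0 \<le> sq_norm \<phi> x"
  using state by (simp_all add: is_state_def sq_norm_def complex_eq_iff)

lemma sq_norm_cscale:
  assumes "x \<in> carrier A"
  shows "sq_norm \<phi> (cscale A c x) = (cmod c)\<^sup>2 * sq_norm \<phi> x"
proof -
  have "complex_of_real (sq_norm \<phi> (cscale A c x)) = complex_of_real ((cmod c)\<^sup>2 * sq_norm \<phi> x)"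
    using assms
    by (simp add: state_positive[symmetric] star_cscale cscale_closed star_closed cscale_mult_left
        cscale_mult_right cscale_cscale state_cscale complex_norm_square mult.commute[of "cnj c"]
        del: of_real_power)
  then show ?thesis
    unfolding of_real_eq_iff .
qed

lemma parallelogram:
  assumes x: "x \<in> carrier A" and y: "y \<in> carrier A"
  shows "sq_norm \<phi> (x \<oplus> y) + sq_norm \<phi> (x \<ominus> y) = 2 * sq_norm \<phi> x + 2 * sq_norm \<phi> y"
proof -
  note c = x y star_closed[OF x] star_closed[OF y]
  have "star A (x \<oplus> y) \<otimes> (x \<oplus> y) \<oplus> star A (x \<ominus> y) \<otimes> (x \<ominus> y)
     = (star A x \<otimes> x \<oplus> star A x \<otimes> x) \<oplus> (star A y \<otimes> y \<oplus> star A y \<otimes> y)"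
    unfolding star_add[OF x y] star_diff[OF x y] using c by algebra
  then have "\<phi> (star A (x \<oplus> y) \<otimes> (x \<oplus> y) \<oplus> star A (x \<ominus> y) \<otimes> (x \<ominus> y))
     = \<phi> ((star A x \<otimes> x \<oplus> star A x \<otimes> x) \<oplus> (star A y \<otimes> y \<oplus> star A y \<otimes> y))"
    by simp
  then have "complex_of_real (sq_norm \<phi> (x \<oplus> y) + sq_norm \<phi> (x \<ominus> y))
     = complex_of_real (2 * sq_norm \<phi> x + 2 * sq_norm \<phi> y)"
    using c by (simp add: state_add state_positive star_closed)
  then show ?thesis
    unfolding of_real_eq_iff .
qed

lemma sq_norm_add_le:
  "\<lbrakk>x \<in> carrier A; y \<in> carrier A\<rbrakk> \<Longrightarrow> sq_norm \<phi> (x \<oplus> y) \<le> 2 * sq_norm \<phi> x + 2 * sq_norm \<phi> y"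
  using parallelogram[of x y] sq_norm_nonneg[of "x \<ominus> y"] by simp

lemma sq_norm_average_le:
  assumes "x \<in> carrier A" "y \<in> carrier A" "sq_norm \<phi> x \<le> e" "sq_norm \<phi> y \<le> e"
  shows "sq_norm \<phi> (cscale A (1/2) (x \<oplus> y)) \<le> e"
  using sq_norm_add_le[of x y] assms by (simp add: sq_norm_cscale power2_eq_square)

text \<open>Left multiplication by \<open>x\<close> is bounded by \<open>\<parallel>x\<parallel>\<close> for the seminorm of a state, since
  \<open>1 - s x\<^sup>* x\<close> has the form \<open>z\<^sup>* z\<close> for \<open>s < \<parallel>x\<parallel>\<^bsup>-2\<^esup>\<close>.\<close>

lemma sq_norm_mult_le:
  assumes x: "x \<in> carrier A" and y: "y \<in> carrier A"
  shows "sq_norm \<phi> (x \<otimes> y) \<le> (cnorm A x)\<^sup>2 * sq_norm \<phi> y"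
proof -
  have bound: "sq_norm \<phi> (x \<otimes> y) \<le> d * sq_norm \<phi> y" if d: "d > (cnorm A x)\<^sup>2" for d
  proof -
    have d0: "d > 0"
      using d zero_le_power2[of "cnorm A x"] by linarith
    define h where "h = cscale A (1 / d) (star A x \<otimes> x)"
    have h: "h \<in> carrier A" "star A h = h"
      using x by (simp_all add: h_def cscale_closed star_closed star_cscale star_mult star_star)
    have "cnorm A h = (cnorm A x)\<^sup>2 / d"
      using x d0 by (simp add: h_def cnorm_cscale star_closed cstar_identity norm_divide)
    then have "cnorm A h < 1"
      using d d0 by simp
    then obtain z where z: "z \<in> carrier A" "star A z \<otimes> z = \<one> \<ominus> h"
      using selfadjoint_sqrt_near_one[OF h] by blast
    have "star A (z \<otimes> y) \<otimes> (z \<otimes> y) = star A y \<otimes> ((star A z \<otimes> z) \<otimes> y)"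
      using z(1) y by (simp add: star_mult star_closed m_assoc)
    also have "\<dots> = star A y \<otimes> y \<ominus> star A y \<otimes> (h \<otimes> y)"
      unfolding z(2) using h(1) y star_closed[OF y] by algebra
    also have "star A y \<otimes> (h \<otimes> y) = cscale A (1 / d) (star A (x \<otimes> y) \<otimes> (x \<otimes> y))"
      using x y by (simp add: h_def star_mult star_closed m_assoc cscale_mult_left cscale_mult_right)
    finally have "complex_of_real (sq_norm \<phi> (z \<otimes> y)) =
        complex_of_real (sq_norm \<phi> y - 1 / d * sq_norm \<phi> (x \<otimes> y))"
      using x y z(1)
      by (simp add: state_positive[symmetric] state_diff state_cscale star_closed cscale_closed)
    then have "sq_norm \<phi> (z \<otimes> y) = sq_norm \<phi> y - 1 / d * sq_norm \<phi> (x \<otimes> y)"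
      unfolding of_real_eq_iff .
    then show ?thesis
      using mult_nonneg_nonneg[OF less_imp_le[OF d0] sq_norm_nonneg[of "z \<otimes> y"]] z(1) y d0
      by (simp add: right_diff_distrib)
  qed
  \<comment> \<open>Let \<open>d\<close> decrease to \<open>\<parallel>x\<parallel>\<^sup>2\<close>; the choice of \<open>d\<close> below makes the error at most \<open>e\<close>, also if \<open>q = 0\<close>.\<close>
  show ?thesis
  proof (rule field_le_epsilon)
    fix e :: real assume e: "e > 0"
    define q where "q = sq_norm \<phi> y"
    have q: "q \<ge> 0"
      using sq_norm_nonneg[OF y] by (simp add: q_def)
    have "sq_norm \<phi> (x \<otimes> y) \<le> ((cnorm A x)\<^sup>2 + e / (q + 1)) * q"
      unfolding q_def[symmetric] using bound[of "(cnorm A x)\<^sup>2 + e / (q + 1)"] e q by (simp add: q_def)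
    also have "e / (q + 1) * q \<le> e"
      using e q by (simp add: divide_simps)
    then have "((cnorm A x)\<^sup>2 + e / (q + 1)) * q \<le> (cnorm A x)\<^sup>2 * q + e"
      by (simp add: distrib_right)
    finally show "sq_norm \<phi> (x \<otimes> y) \<le> (cnorm A x)\<^sup>2 * sq_norm \<phi> y + e"
      by (simp add: q_def)
  qed
qed

lemma sq_norm_le: "x \<in> carrier A \<Longrightarrow> sq_norm \<phi> x \<le> (cnorm A x)\<^sup>2"
  using sq_norm_mult_le[of x \<one>] by (simp add: sq_norm_def state_one)

lemma sq_norm_mult_zero:
  "\<lbrakk>x \<in> carrier A; y \<in> carrier A; sq_norm \<phi> y = 0\<rbrakk> \<Longrightarrow> sq_norm \<phi> (x \<otimes> y) = 0"
  using sq_norm_mult_le[of x y] sq_norm_nonneg[of "x \<otimes> y"] by simp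

end

lemma star_homD:
  assumes "star_hom A A g"
  shows "x \<in> carrier A \<Longrightarrow> g x \<in> carrier A"
    and "\<lbrakk>x \<in> carrier A; y \<in> carrier A\<rbrakk> \<Longrightarrow> g (x \<oplus> y) = g x \<oplus> g y"
    and "\<lbrakk>x \<in> carrier A; y \<in> carrier A\<rbrakk> \<Longrightarrow> g (x \<otimes> y) = g x \<otimes> g y"
    and "g \<one> = \<one>"
    and "x \<in> carrier A \<Longrightarrow> g (cscale A c x) = cscale A c (g x)"
    and "x \<in> carrier A \<Longrightarrow> g (star A x) = star A (g x)"
  using assms by (auto simp: star_hom_def ring_hom_def)

lemma star_hom_diff:
  assumes "star_hom A A g" "x \<in> carrier A" "y \<in> carrier A"
  shows "g (x \<ominus> y) = g x \<ominus> g y"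
  using assms(2,3) by (simp add: minus_eq_cscale star_homD[OF assms(1)] cscale_closed)

lemma star_hom_zero:
  assumes "star_hom A A g"
  shows "g \<zero> = \<zero>"
  using star_homD(5)[OF assms zero_closed, of 0] star_homD(1)[OF assms zero_closed] by simp

lemma mprod_simps [simp]:
  "mprod A [] = \<one>" "mprod A (x # xs) = x \<otimes> mprod A xs"
  by (simp_all add: mprod_def)

lemma mprod_closed: "set xs \<subseteq> carrier A \<Longrightarrow> mprod A xs \<in> carrier A"
  by (induction xs) auto

lemma
  assumes g: "star_hom A A g" and \<phi>: "is_state A \<phi>"
  shows is_state_comp: "is_state A (\<phi> \<circ> g)"
    and sq_norm_comp: "x \<in> carrier A \<Longrightarrow> sq_norm (\<phi> \<circ> g) x = sq_norm \<phi> (g x)"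
  using \<phi> by (simp_all add: is_state_def sq_norm_def star_homD[OF g] star_closed)

end

section \<open>The CAR algebra and its gauge-invariant part\<close>

lemma unitary_opD:
  assumes "unitary_op V"
  shows "bounded_clinear V" "surj V" "cinner (V x) (V y) = cinner x y"
  using assms by (auto simp: unitary_op_def)

lemma unitary_op_scaleC:
  assumes "cmod z = 1"
  shows "unitary_op (\<lambda>x. z *\<^sub>C x)"
proof -
  have zz: "z * cnj z = 1"
    using assms by (simp add: complex_norm_square[symmetric])
  have "z *\<^sub>C cnj z *\<^sub>C x = x" for x
    by (simp add: scaleC_scaleC zz)
  then have "surj (\<lambda>x. z *\<^sub>C x)"
    by (metis surjI)
  then show ?thesis
    using zz by (simp add: unitary_op_def bounded_clinear_def bounded_linear_scaleC scaleC_scaleC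
        cinner_simps mult.assoc[symmetric] mult.commute)
qed

lemma unitary_op_inverse:
  assumes V: "unitary_op V"
  shows "\<exists>W. unitary_op W \<and> (\<forall>x. V (W x) = x) \<and> (\<forall>x. W (V x) = x)"
proof -
  note lin = bounded_clinearD[OF unitary_opD(1)[OF V]]
  have inj: "x = y" if "V x = V y" for x y
  proof -
    have "cinner (x - y) (x - y) = cinner (V (x - y)) (V (x - y))"
      by (simp add: unitary_opD(3)[OF V])
    then show ?thesis
      using that by (simp add: lin)
  qed
  define W where "W = inv_into UNIV V"
  have VW: "V (W x) = x" for x
    using unitary_opD(2)[OF V] by (simp add: W_def surj_f_inv_f)
  have WV: "W (V x) = x" for x
    using VW inj by blast
  have c: "cinner (W x) (W y) = cinner x y" for x y
    using unitary_opD(3)[OF V, of "W x" "W y"] by (simp add: VW)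
  have n: "norm (W x) = norm x" for x
    using c[of x x] by (simp add: cinner_self flip: of_real_power)
  have s: "W (c *\<^sub>C x) = c *\<^sub>C W x" for c x
    by (rule inj) (simp add: VW lin)
  have "bounded_linear W"
  proof (rule bounded_linear_intro[where K=1])
    show "W (x + y) = W x + W y" for x y
      by (rule inj) (simp add: VW lin)
    show "W (r *\<^sub>R x) = r *\<^sub>R W x" for r x
      by (simp add: scaleR_eq_scaleC s)
  qed (simp add: n)
  then have "unitary_op W"
    unfolding unitary_op_def bounded_clinear_def using s c surjI[of W V, OF WV] by simp
  then show ?thesis
    using VW WV by blast
qed

locale car_algebra = unital_cstar_algebra A for A :: "'a cstar_alg" (structure) +
  fixes a :: "'h::complex_inner \<Rightarrow> 'a"
  assumes car: "is_car_algebra A a"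
begin

abbreviation ad :: "'h \<Rightarrow> 'a" where "ad h \<equiv> star A (a h)"

lemma car_relations: "car_relations A a"
  using car by (simp add: is_car_algebra_def)

lemma a_closed [simp]: "a h \<in> carrier A"
  using car_relations by (auto simp: car_relations_def)

lemma ad_closed [simp]: "ad h \<in> carrier A"
  by (simp add: star_closed)

lemma a_add: "a (h + k) = a h \<oplus> a k"
proof -
  have "star A (ad (h + k)) = star A (ad h \<oplus> ad k)"
    using car_relations by (simp add: car_relations_def)
  then show ?thesis
    by (simp add: star_star star_add)
qed

lemma a_scaleC: "a (c *\<^sub>C h) = cscale A (cnj c) (a h)"
proof -
  have "star A (ad (c *\<^sub>C h)) = star A (cscale A c (ad h))"
    using car_relations by (simp add: car_relations_def)
  then show ?thesis
    by (simp add: star_star star_cscale)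
qed

lemma a_zero: "a 0 = \<zero>"
  using a_scaleC[of 0 0] by simp

lemma a_diff: "a (h - k) = a h \<ominus> a k"
  using a_add[of h "- 1 *\<^sub>C k"] by (simp only: a_scaleC minus_eq_cscale a_closed) simp

lemma anticommute_a_a: "a h \<otimes> a k = \<ominus> (a k \<otimes> a h)"
  using car_relations by (intro minus_equality[symmetric]) (auto simp: car_relations_def)

lemma anticommute_ad_ad: "ad h \<otimes> ad k = \<ominus> (ad k \<otimes> ad h)"
  using arg_cong[OF anticommute_a_a[of k h], of "star A"] by (simp add: star_mult star_minus)

lemma ad_a_add_a_ad: "ad h \<otimes> a k \<oplus> a k \<otimes> ad h = cscale A (cinner h k) \<one>"
  using car_relations by (auto simp: car_relations_def)

lemma a_ad_eq: "a k \<otimes> ad h = cscale A (cinner h k) \<one> \<ominus> ad h \<otimes> a k"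
  unfolding ad_a_add_a_ad[symmetric] using ad_closed[of h] a_closed[of k] by algebra

lemma ad_a_eq: "ad h \<otimes> a k = cscale A (cinner h k) \<one> \<ominus> a k \<otimes> ad h"
  unfolding ad_a_add_a_ad[symmetric] using ad_closed[of h] a_closed[of k] by algebra

lemma a_square: "a h \<otimes> a h = \<zero>"
proof -
  have "a h \<otimes> a h \<oplus> a h \<otimes> a h = \<zero>"
    using car_relations by (simp add: car_relations_def)
  then show ?thesis
    using cscale_half_double[of "a h \<otimes> a h"] by simp
qed

text \<open>Since \<open>a(h)\<^sup>2 = 0\<close>, the anticommutator gives \<open>(a(h)\<^sup>* a(h))\<^sup>2 = \<parallel>h\<parallel>\<^sup>2 a(h)\<^sup>* a(h)\<close>, and the
  C*-identity turns this into a bound for the norm.\<close>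

lemma cnorm_a_le: "cnorm A (a h) \<le> norm h"
proof -
  define n where "n = ad h \<otimes> a h"
  have n: "n \<in> carrier A" "star A n = n"
    by (simp_all add: n_def star_mult star_star)
  have "n \<otimes> n = ad h \<otimes> ((a h \<otimes> ad h) \<otimes> a h)"
    by (simp add: n_def m_assoc)
  also have "\<dots> = ad h \<otimes> (cscale A (cinner h h) (a h) \<ominus> ad h \<otimes> (a h \<otimes> a h))"
    by (simp add: a_ad_eq a_minus_def l_distr l_minus cscale_mult_left m_assoc cscale_closed)
  also have "\<dots> = cscale A (cinner h h) n"
    by (simp add: a_square n_def cscale_mult_right cscale_closed a_minus_def)
  finally have "cnorm A (star A n \<otimes> n) = (norm h)\<^sup>2 * cnorm A n"
    using n by (simp add: cnorm_cscale cinner_self norm_power)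
  then have "cnorm A n * cnorm A n = (norm h)\<^sup>2 * cnorm A n"
    using n(1) by (simp add: cstar_identity power2_eq_square)
  then have "cnorm A n \<le> (norm h)\<^sup>2"
    using cnorm_nonneg[OF n(1)] by (cases "cnorm A n = 0") auto
  then have "(cnorm A (a h))\<^sup>2 \<le> (norm h)\<^sup>2"
    by (simp add: n_def cstar_identity)
  then show ?thesis
    by (rule power2_le_imp_le) simp
qed

lemma generated:
  "\<lbrakk>closed_star_subalgebra A S; range a \<subseteq> S\<rbrakk> \<Longrightarrow> S = carrier A"
  using car by (simp add: is_car_algebra_def)

lemma hom_unique_exists:
  assumes "car_relations A b"
  shows "\<exists>!\<pi>. \<pi> \<in> extensional (carrier A) \<and> star_hom A A \<pi> \<and> (\<forall>h. \<pi> (a h) = b h)"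
  using car assms unital_cstar_algebra_axioms by (simp add: is_car_algebra_def)

lemma hom_unique:
  assumes "car_relations A b"
    and "\<pi> \<in> extensional (carrier A)" "star_hom A A \<pi>" "\<And>h. \<pi> (a h) = b h"
    and "\<pi>' \<in> extensional (carrier A)" "star_hom A A \<pi>'" "\<And>h. \<pi>' (a h) = b h"
  shows "\<pi> = \<pi>'"
proof -
  obtain \<sigma> where "\<And>\<tau>. \<tau> \<in> extensional (carrier A) \<and> star_hom A A \<tau> \<and> (\<forall>h. \<tau> (a h) = b h) \<Longrightarrow> \<tau> = \<sigma>"
    using hom_unique_exists[OF assms(1)] by (elim ex1E) blast
  from this[of \<pi>] this[of \<pi>'] show ?thesis
    by (simp add: assms)
qed

lemma car_relations_comp:
  assumes "unitary_op V"
  shows "car_relations A (a \<circ> V)"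
  using car_relations unitary_opD(3)[OF assms] bounded_clinearD[OF unitary_opD(1)[OF assms]]
  by (auto simp: car_relations_def)

text \<open>The universal property provides a *-homomorphism for every unitary. The one of the inverse
  unitary is its inverse, so it is an automorphism and the one chosen by \<open>car_aut\<close>.\<close>

lemma car_aut_props:
  assumes V: "unitary_op V"
  shows "star_hom A A (car_aut A a V)" and "car_aut A a V (a h) = a (V h)"
proof -
  have ex: "\<exists>\<pi>. \<pi> \<in> extensional (carrier A) \<and> star_hom A A \<pi> \<and> (\<forall>h. \<pi> (a h) = a (V h))"
    if "unitary_op V" for V
    using hom_unique_exists[OF car_relations_comp[OF that]] by auto
  have inverse: "\<pi>' (\<pi> x) = x"
    if \<pi>: "star_hom A A \<pi>" "\<And>h. \<pi> (a h) = a (V h)"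
      and \<pi>': "star_hom A A \<pi>'" "\<And>h. \<pi>' (a h) = a (V' h)"
      and VV': "\<And>x. V' (V x) = x" and x: "x \<in> carrier A" for \<pi> \<pi>' V V' x
  proof -
    let ?id = "restrict (\<lambda>x. x) (carrier A)" and ?c = "restrict (\<lambda>x. \<pi>' (\<pi> x)) (carrier A)"
    have "star_hom A A ?id"
      by (simp add: star_hom_def ring_hom_def cscale_closed star_closed)
    moreover have "star_hom A A ?c"
      by (simp add: star_hom_def ring_hom_def cscale_closed star_closed star_homD[OF \<pi>(1)]
          star_homD[OF \<pi>'(1)])
    ultimately have "?c = ?id"
      by (intro hom_unique[OF car_relations]) (simp_all add: \<pi>(2) \<pi>'(2) VV')
    then show ?thesis
      using x by (metis restrict_apply')
  qed
  obtain W where W: "unitary_op W" "\<And>x. V (W x) = x" "\<And>x. W (V x) = x"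
    using unitary_op_inverse[OF V] by blast
  obtain \<pi> where \<pi>: "\<pi> \<in> extensional (carrier A)" "star_hom A A \<pi>" "\<And>h. \<pi> (a h) = a (V h)"
    using ex[OF V] by blast
  obtain \<pi>' where \<pi>': "star_hom A A \<pi>'" "\<And>h. \<pi>' (a h) = a (W h)"
    using ex[OF W(1)] by blast
  have "bij_betw \<pi> (carrier A) (carrier A)"
  proof (rule bij_betw_byWitness[where f'=\<pi>'])
    show "\<forall>x\<in>carrier A. \<pi>' (\<pi> x) = x"
      using inverse[OF \<pi>(2,3) \<pi>' W(3)] by blast
    show "\<forall>x\<in>carrier A. \<pi> (\<pi>' x) = x"
      using inverse[OF \<pi>' \<pi>(2,3) W(2)] by blast
  qed (auto simp: star_homD[OF \<pi>(2)] star_homD[OF \<pi>'(1)])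
  then have *: "\<pi> \<in> extensional (carrier A) \<and> star_automorphism A \<pi> \<and> (\<forall>h. \<pi> (a h) = a (V h))"
    using \<pi> by (simp add: star_automorphism_def)
  moreover have "\<pi>'' = \<pi>"
    if "\<pi>'' \<in> extensional (carrier A) \<and> star_automorphism A \<pi>'' \<and> (\<forall>h. \<pi>'' (a h) = a (V h))" for \<pi>''
    using that \<pi> by (intro hom_unique[OF car_relations_comp[OF V]]) (auto simp: star_automorphism_def)
  ultimately have "car_aut A a V = \<pi>"
    unfolding car_aut_def by (rule the_equality)
  then show "star_hom A A (car_aut A a V)" "car_aut A a V (a h) = a (V h)"
    using \<pi> by simp_all
qed

abbreviation gauge :: "complex \<Rightarrow> 'a \<Rightarrow> 'a" where
  "gauge z \<equiv> car_aut A a (\<lambda>h. z *\<^sub>C h)"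

lemma gauge_hom: "cmod z = 1 \<Longrightarrow> star_hom A A (gauge z)"
  and gauge_a: "cmod z = 1 \<Longrightarrow> gauge z (a h) = cscale A (cnj z) (a h)"
  by (simp_all add: car_aut_props unitary_op_scaleC a_scaleC)

lemma gicar_iff: "x \<in> gicar A a \<longleftrightarrow> x \<in> carrier A \<and> (\<forall>z. cmod z = 1 \<longrightarrow> gauge z x = x)"
  by (simp add: gicar_def)

lemma gicar_closed: "x \<in> gicar A a \<Longrightarrow> x \<in> carrier A"
  by (simp add: gicar_iff)

lemma
  shows gicar_add: "\<lbrakk>x \<in> gicar A a; y \<in> gicar A a\<rbrakk> \<Longrightarrow> x \<oplus> y \<in> gicar A a"
    and gicar_mult: "\<lbrakk>x \<in> gicar A a; y \<in> gicar A a\<rbrakk> \<Longrightarrow> x \<otimes> y \<in> gicar A a"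
    and gicar_cscale: "x \<in> gicar A a \<Longrightarrow> cscale A c x \<in> gicar A a"
    and gicar_star: "x \<in> gicar A a \<Longrightarrow> star A x \<in> gicar A a"
    and gicar_zero: "\<zero> \<in> gicar A a"
    and gicar_one: "\<one> \<in> gicar A a"
  by (simp_all add: gicar_iff star_homD[OF gauge_hom] star_hom_zero[OF gauge_hom] cscale_closed
      star_closed)

lemma gicar_diff: "\<lbrakk>x \<in> gicar A a; y \<in> gicar A a\<rbrakk> \<Longrightarrow> x \<ominus> y \<in> gicar A a"
  by (simp add: minus_eq_cscale gicar_closed gicar_add gicar_cscale)

lemma ad_a_gicar: "ad h \<otimes> a h \<in> gicar A a"
  and a_ad_gicar: "a h \<otimes> ad h \<in> gicar A a"
proof -
  have "z * cnj z = 1" "cnj z * z = 1" if "cmod z = 1" for z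
    using that by (simp_all add: complex_norm_square[symmetric] mult.commute[of "cnj z"])
  then show "ad h \<otimes> a h \<in> gicar A a" "a h \<otimes> ad h \<in> gicar A a"
    by (simp_all add: gicar_iff star_homD[OF gauge_hom] gauge_a star_cscale cscale_mult_left
        cscale_mult_right cscale_cscale cscale_closed cscale_one)
qed

end

section \<open>Excitation monomials and their gauge degree\<close>

locale car_basis = car_algebra A a
  for A :: "'a cstar_alg" (structure) and a :: "'h::complex_inner \<Rightarrow> 'a" +
  fixes v :: "'i \<Rightarrow> 'h" and I I0 :: "'i set"
  assumes onb: "orthonormal_basis I v" and I0: "I0 \<subseteq> I"
begin

lemma cinner_basis: "\<alpha> \<in> I \<Longrightarrow> \<beta> \<in> I \<Longrightarrow> cinner (v \<alpha>) (v \<beta>) = (if \<alpha> = \<beta> then 1 else 0)"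
  using onb by (simp add: orthonormal_basis_def)

definition word :: "'i list \<Rightarrow> 'i list \<Rightarrow> 'a" where
  "word \<alpha>s \<beta>s = mprod A (map (\<lambda>\<alpha>. ad (v \<alpha>)) \<alpha>s @ map (\<lambda>\<beta>. a (v \<beta>)) \<beta>s)"

lemma word_closed [simp]: "word \<alpha>s \<beta>s \<in> carrier A"
  unfolding word_def by (rule mprod_closed) auto

lemma word_Nil [simp]: "word [] [] = \<one>"
  and word_Cons_left: "word (\<alpha> # \<alpha>s) \<beta>s = ad (v \<alpha>) \<otimes> word \<alpha>s \<beta>s"
  and word_Cons_right: "word [] (\<beta> # \<beta>s) = a (v \<beta>) \<otimes> word [] \<beta>s"
  by (simp_all add: word_def)

lemma star_hom_word:
  assumes g: "star_hom A A g"
    and gv: "\<And>\<gamma>. \<gamma> \<in> set \<alpha>s \<union> set \<beta>s \<Longrightarrow> g (a (v \<gamma>)) = cscale A (cnj (c \<gamma>)) (a (v \<gamma>))"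
  shows "g (word \<alpha>s \<beta>s) =
    cscale A (prod_list (map c \<alpha>s) * prod_list (map (\<lambda>\<beta>. cnj (c \<beta>)) \<beta>s)) (word \<alpha>s \<beta>s)"
  using gv
proof (induction \<alpha>s)
  case Nil
  then show ?case
  proof (induction \<beta>s)
    case Nil
    then show ?case by (simp add: star_homD[OF g] cscale_one)
  next
    case (Cons \<beta> \<beta>s)
    then show ?case
      by (simp add: word_Cons_right star_homD[OF g] cscale_mult_left cscale_mult_right
          cscale_cscale cscale_closed mult.commute)
  qed
next
  case (Cons \<alpha> \<alpha>s)
  then show ?case
    by (simp add: word_Cons_left star_homD[OF g] cscale_mult_left cscale_mult_right
        cscale_cscale cscale_closed star_cscale mult_ac)
qed

lemma gauge_word:
  assumes "cmod z = 1"
  shows "gauge z (word \<alpha>s \<beta>s) = cscale A (z ^ length \<alpha>s * cnj z ^ length \<beta>s) (word \<alpha>s \<beta>s)"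
  using star_hom_word[OF gauge_hom[OF assms], of \<alpha>s \<beta>s "\<lambda>_. z"] gauge_a[OF assms]
  by (simp add: map_replicate_const prod_list_replicate)

lemma word_gicar: "length \<alpha>s = length \<beta>s \<Longrightarrow> word \<alpha>s \<beta>s \<in> gicar A a"
  by (simp add: gicar_iff gauge_word cscale_one complex_norm_square[symmetric] flip: power_mult_distrib)

text \<open>Complex linear combinations of excitation monomials; \<open>D\<close> restricts their gauge degrees, so that
  degrees can be removed one at a time.\<close>

inductive_set words :: "int set \<Rightarrow> 'a set" for D where
  words_zero: "\<zero> \<in> words D"
| words_step: "set \<alpha>s \<subseteq> I - I0 \<Longrightarrow> set \<beta>s \<subseteq> I0 \<Longrightarrow> int (length \<alpha>s) - int (length \<beta>s) \<in> D \<Longrightarrow>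
    x \<in> words D \<Longrightarrow> cscale A c (word \<alpha>s \<beta>s) \<oplus> x \<in> words D"

lemma words_closed: "x \<in> words D \<Longrightarrow> x \<in> carrier A"
  by (induction rule: words.induct) (simp_all add: cscale_closed)

lemma words_mono: "x \<in> words D \<Longrightarrow> D \<subseteq> D' \<Longrightarrow> x \<in> words D'"
  by (induction rule: words.induct) (auto intro: words.intros)

lemma words_add: "x \<in> words D \<Longrightarrow> y \<in> words D \<Longrightarrow> x \<oplus> y \<in> words D"
  by (induction rule: words.induct)
     (auto simp: words_closed a_assoc cscale_closed intro!: words.intros)

lemma words_cscale: "x \<in> words D \<Longrightarrow> cscale A c x \<in> words D"
  by (induction rule: words.induct)
     (auto simp: words_closed cscale_add_right cscale_closed cscale_cscale intro!: words.intros)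

lemma word_in_words:
  assumes "set \<alpha>s \<subseteq> I - I0" "set \<beta>s \<subseteq> I0" "int (length \<alpha>s) - int (length \<beta>s) \<in> D"
  shows "word \<alpha>s \<beta>s \<in> words D"
  using words_step[OF assms words_zero, of 1] by (simp add: cscale_one)

lemma words_finite_degrees: "x \<in> words D \<Longrightarrow> \<exists>F. finite F \<and> x \<in> words F"
proof (induction rule: words.induct)
  case (words_step \<alpha>s \<beta>s x c)
  then obtain F where F: "finite F" "x \<in> words F" by blast
  let ?F = "insert (int (length \<alpha>s) - int (length \<beta>s)) F"
  have "cscale A c (word \<alpha>s \<beta>s) \<oplus> x \<in> words ?F"
    using words_step.hyps words_mono[OF F(2), of ?F] by (intro words.words_step) auto
  then show ?case
    using F(1) by blast
qed (auto intro: words.intros)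

text \<open>The gauge transformation by \<open>exp (i \<pi> / d)\<close> changes the sign of the monomials of degree \<open>d\<close>
  and multiplies those of any other degree by a scalar.\<close>

lemma gauge_average_kills_degree:
  assumes d: "d \<noteq> 0" and x: "x \<in> words F"
  shows "cscale A (1/2) (x \<oplus> gauge (cis (pi / of_int d)) x) \<in> words (F - {d})"
  using x
proof (induction rule: words.induct)
  case words_zero
  then show ?case
    by (simp add: star_hom_zero[OF gauge_hom] words.intros)
next
  case (words_step \<alpha>s \<beta>s x c)
  define g where "g = gauge (cis (pi / of_int d))"
  have g: "star_hom A A g"
    by (simp add: g_def gauge_hom)
  define k where "k = int (length \<alpha>s) - int (length \<beta>s)"
  define w where "w = word \<alpha>s \<beta>s"
  define s where "s = cis (of_int k * (pi / of_int d))"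
  have w: "w \<in> carrier A" and x: "x \<in> carrier A"
    by (simp_all add: w_def words_closed[OF words_step.hyps(4)])
  have "cis (pi / of_int d) ^ length \<alpha>s * cnj (cis (pi / of_int d)) ^ length \<beta>s = s"
    unfolding cis_cnj Complex.DeMoivre cis_mult s_def k_def by (simp add: left_diff_distrib diff_divide_distrib)
  then have "g w = cscale A s w"
    by (simp add: g_def w_def gauge_word)
  then have "g (cscale A c w \<oplus> x) = cscale A (c * s) w \<oplus> g x"
    using w x by (simp add: star_homD[OF g] cscale_closed cscale_cscale)
  then have "cscale A (1/2) ((cscale A c w \<oplus> x) \<oplus> g (cscale A c w \<oplus> x))
      = cscale A (c / 2 * (1 + s)) w \<oplus> cscale A (1/2) (x \<oplus> g x)"
    using w x star_homD(1)[OF g x]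
    by (simp add: cscale_add_right cscale_add_left cscale_cscale cscale_closed distrib_left a_ac)
  also have "\<dots> \<in> words (F - {d})"
  proof (cases "k = d")
    case True
    then have "s = - 1"
      using d by (simp add: s_def)
    then show ?thesis
      using words_step.IH w x star_homD(1)[OF g x] by (simp add: g_def cscale_closed)
  next
    case False
    then show ?thesis
      unfolding w_def using words_step by (intro words.words_step) (auto simp: k_def g_def)
  qed
  finally show ?case
    by (simp add: g_def w_def)
qed


section \<open>Approximation by excitation monomials\<close>

text \<open>The states in which the annihilators \<open>a(v\<^sub>\<alpha>)\<close> for \<open>\<alpha> \<notin> I0\<close> and \<open>a(v\<^sub>\<beta>)\<^sup>*\<close> for \<open>\<beta> \<in> I0\<close> act as
  zero on the cyclic vector. Working with all of them at once replaces the uniqueness of such a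
  state and its gauge invariance.\<close>

definition vacuum :: "('a \<Rightarrow> complex) \<Rightarrow> bool" where
  "vacuum \<psi> \<longleftrightarrow> is_state A \<psi> \<and> (\<forall>\<alpha>\<in>I - I0. sq_norm \<psi> (a (v \<alpha>)) = 0)
     \<and> (\<forall>\<beta>\<in>I0. sq_norm \<psi> (ad (v \<beta>)) = 0)"

text \<open>The bound is uniform over the states, so that it is inherited by compositions with gauge
  transformations.\<close>

definition near :: "'a \<Rightarrow> 'a \<Rightarrow> real \<Rightarrow> bool" where
  "near x y e \<longleftrightarrow> (\<forall>\<psi>. vacuum \<psi> \<longrightarrow> sq_norm \<psi> (x \<ominus> y) \<le> e)"

definition approx :: "'a set" where
  "approx = {x \<in> carrier A. \<forall>e>0. \<exists>y\<in>words UNIV. near x y e}"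

lemma vacuum_state: "vacuum \<psi> \<Longrightarrow> is_state A \<psi>"
  by (simp add: vacuum_def)

lemma near_trans:
  assumes "x \<in> carrier A" "y \<in> carrier A" "z \<in> carrier A" "near x y e" "near y z e'"
  shows "near x z (2 * e + 2 * e')"
  unfolding near_def
proof (intro allI impI)
  fix \<psi> assume \<psi>: "vacuum \<psi>"
  have "sq_norm \<psi> (x \<ominus> z) \<le> 2 * sq_norm \<psi> (x \<ominus> y) + 2 * sq_norm \<psi> (y \<ominus> z)"
    using sq_norm_add_le[OF vacuum_state[OF \<psi>], of "x \<ominus> y" "y \<ominus> z"] assms
    by (simp add: diff_add_diff)
  then show "sq_norm \<psi> (x \<ominus> z) \<le> 2 * e + 2 * e'"
    using assms(4,5) \<psi> by (force simp: near_def)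
qed

lemma near_refl: "x \<in> carrier A \<Longrightarrow> 0 \<le> e \<Longrightarrow> near x x e"
  using sq_norm_le[OF vacuum_state, of _ \<zero>] by (fastforce simp: near_def a_minus_def r_neg)

lemma near_mult:
  assumes "s \<in> carrier A" "x \<in> carrier A" "y \<in> carrier A" "near x y e"
  shows "near (s \<otimes> x) (s \<otimes> y) ((cnorm A s)\<^sup>2 * e)"
  unfolding near_def
proof (intro allI impI)
  fix \<psi> assume \<psi>: "vacuum \<psi>"
  have "s \<otimes> x \<ominus> s \<otimes> y = s \<otimes> (x \<ominus> y)"
    using assms by algebra
  then have "sq_norm \<psi> (s \<otimes> x \<ominus> s \<otimes> y) \<le> (cnorm A s)\<^sup>2 * sq_norm \<psi> (x \<ominus> y)"
    using sq_norm_mult_le[OF vacuum_state[OF \<psi>], of s "x \<ominus> y"] assms by simp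
  also have "\<dots> \<le> (cnorm A s)\<^sup>2 * e"
    using assms(4) \<psi> by (simp add: near_def mult_left_mono)
  finally show "sq_norm \<psi> (s \<otimes> x \<ominus> s \<otimes> y) \<le> (cnorm A s)\<^sup>2 * e" .
qed

lemma approx_closed: "x \<in> approx \<Longrightarrow> x \<in> carrier A"
  by (simp add: approx_def)

lemma words_approx: "x \<in> words UNIV \<Longrightarrow> x \<in> approx"
  unfolding approx_def using near_refl[of x] words_closed[of x UNIV] less_imp_le by blast

lemma word_approx: "set \<alpha>s \<subseteq> I - I0 \<Longrightarrow> set \<beta>s \<subseteq> I0 \<Longrightarrow> word \<alpha>s \<beta>s \<in> approx"
  by (simp add: words_approx word_in_words)

lemma approx_limit:
  assumes x: "x \<in> carrier A" and lim: "\<And>e. e > 0 \<Longrightarrow> \<exists>y\<in>approx. near x y e"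
  shows "x \<in> approx"
  unfolding approx_def
proof (intro CollectI conjI allI impI x)
  fix e :: real assume e: "e > 0"
  then obtain y where y: "y \<in> approx" "near x y (e / 4)"
    using lim[of "e / 4"] by auto
  then obtain z where z: "z \<in> words UNIV" "near y z (e / 4)"
    using e unfolding approx_def by (auto dest!: spec[of _ "e / 4"])
  have "near x z (2 * (e / 4) + 2 * (e / 4))"
    by (rule near_trans[OF x approx_closed[OF y(1)] words_closed[OF z(1)] y(2) z(2)])
  then show "\<exists>y\<in>words UNIV. near x y e"
    using z(1) by auto
qed

lemma approx_null:
  assumes "x \<in> carrier A" "\<And>\<psi>. vacuum \<psi> \<Longrightarrow> sq_norm \<psi> x = 0"
  shows "x \<in> approx"
proof (rule approx_limit[OF assms(1)])
  fix e :: real assume "e > 0"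
  then have "near x \<zero> e"
    using assms by (simp add: near_def a_minus_def)
  then show "\<exists>y\<in>approx. near x y e"
    using words_approx[OF words_zero] by blast
qed

lemma approx_cscale: 
  assumes x: "x \<in> approx"
  shows "cscale A c x \<in> approx"
proof (rule approx_limit)
  note xc = approx_closed[OF x]
  show "cscale A c x \<in> carrier A"
    by (simp add: cscale_closed xc)
  fix e :: real assume e: "e > 0"
  define n where "n = (cnorm A (cscale A c \<one>))\<^sup>2 + 1"
  have n: "n > 0"
    by (simp add: n_def add_nonneg_pos)
  obtain y where y: "y \<in> words UNIV" "near x y (e / n)"
    using x e n unfolding approx_def by (auto dest!: spec[of _ "e / n"])
  note yc = words_closed[OF y(1)]
  have "near (cscale A c x) (cscale A c y) ((n - 1) * (e / n))"
    using near_mult[OF cscale_closed[OF one_closed] xc yc y(2), of c] xc yc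
    by (simp add: cscale_mult_left n_def)
  moreover have "(n - 1) * (e / n) \<le> e"
    using e n by (simp add: divide_simps)
  ultimately have "near (cscale A c x) (cscale A c y) e"
    unfolding near_def by force
  then show "\<exists>y\<in>approx. near (cscale A c x) y e"
    using words_approx[OF words_cscale[OF y(1)]] by blast
qed

lemma approx_add:
  assumes x: "x \<in> approx" and y: "y \<in> approx"
  shows "x \<oplus> y \<in> approx"
proof (rule approx_limit)
  note xc = approx_closed[OF x] and yc = approx_closed[OF y]
  show "x \<oplus> y \<in> carrier A"
    by (simp add: xc yc)
  fix e :: real assume e: "e > 0"
  then obtain x' y' where x': "x' \<in> words UNIV" "near x x' (e / 4)"
    and y': "y' \<in> words UNIV" "near y y' (e / 4)"
    using x y unfolding approx_def by (auto dest!: spec[of _ "e / 4"])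
  note c = xc yc words_closed[OF x'(1)] words_closed[OF y'(1)]
  have eq: "(x \<oplus> y) \<ominus> (x' \<oplus> y') = (x \<ominus> x') \<oplus> (y \<ominus> y')"
    using c by algebra
  have "near (x \<oplus> y) (x' \<oplus> y') e"
    unfolding near_def
  proof (intro allI impI)
    fix \<psi> assume \<psi>: "vacuum \<psi>"
    have "sq_norm \<psi> ((x \<oplus> y) \<ominus> (x' \<oplus> y')) \<le> 2 * sq_norm \<psi> (x \<ominus> x') + 2 * sq_norm \<psi> (y \<ominus> y')"
      unfolding eq using c by (intro sq_norm_add_le[OF vacuum_state[OF \<psi>]]) auto
    then show "sq_norm \<psi> ((x \<oplus> y) \<ominus> (x' \<oplus> y')) \<le> e"
      using x'(2) y'(2) \<psi> unfolding near_def by force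
  qed
  then show "\<exists>z\<in>approx. near (x \<oplus> y) z e"
    using words_approx[OF words_add[OF x'(1) y'(1)]] by blast
qed

lemma approx_minus: "x \<in> approx \<Longrightarrow> \<ominus> x \<in> approx"
  by (metis approx_cscale approx_closed cscale_minus_one)

text \<open>As left multiplication is continuous and \<open>approx\<close> is a closed subspace, it suffices to look at
  monomials.\<close>

lemma approx_letter:
  assumes b: "b \<in> carrier A"
    and bw: "\<And>\<alpha>s \<beta>s. set \<alpha>s \<subseteq> I - I0 \<Longrightarrow> set \<beta>s \<subseteq> I0 \<Longrightarrow> b \<otimes> word \<alpha>s \<beta>s \<in> approx"
    and x: "x \<in> approx"
  shows "b \<otimes> x \<in> approx"
proof (rule approx_limit)
  note xc = approx_closed[OF x]
  show "b \<otimes> x \<in> carrier A"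
    by (simp add: b xc)
  have words: "b \<otimes> y \<in> approx" if "y \<in> words UNIV" for y
    using that
  proof (induction rule: words.induct)
    case words_zero
    then show ?case
      using b words_approx[OF words.words_zero] by simp
  next
    case (words_step \<alpha>s \<beta>s y c)
    then show ?case
      using b words_closed[OF words_step.hyps(4)]
      by (simp add: r_distr cscale_closed cscale_mult_right approx_add approx_cscale bw)
  qed
  fix e :: real assume e: "e > 0"
  define n where "n = (cnorm A b)\<^sup>2 + 1"
  have n: "n > 0"
    by (simp add: n_def add_nonneg_pos)
  obtain y where y: "y \<in> words UNIV" "near x y (e / n)"
    using x e n unfolding approx_def by (auto dest!: spec[of _ "e / n"])
  have "near (b \<otimes> x) (b \<otimes> y) ((n - 1) * (e / n))"
    using near_mult[OF b xc words_closed[OF y(1)] y(2)] by (simp add: n_def)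
  moreover have "(n - 1) * (e / n) \<le> e"
    using e n by (simp add: divide_simps)
  ultimately have "near (b \<otimes> x) (b \<otimes> y) e"
    unfolding near_def by force
  then show "\<exists>y\<in>approx. near (b \<otimes> x) y e"
    using words[OF y(1)] by blast
qed

lemma a_word_Cons_left:
  "a k \<otimes> word (\<alpha> # \<alpha>s) \<beta>s =
    cscale A (cinner (v \<alpha>) k) (word \<alpha>s \<beta>s) \<ominus> ad (v \<alpha>) \<otimes> (a k \<otimes> word \<alpha>s \<beta>s)"
  by (simp add: word_Cons_left m_assoc[symmetric] a_ad_eq)
     (simp add: a_minus_def l_distr l_minus cscale_mult_left cscale_closed m_assoc)

lemma a_word_Cons_right: "a k \<otimes> word [] (\<beta> # \<beta>s) = \<ominus> (a (v \<beta>) \<otimes> (a k \<otimes> word [] \<beta>s))"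
  by (simp add: word_Cons_right m_assoc[symmetric] anticommute_a_a[of k] l_minus)

lemma ad_word_Cons_left: "ad h \<otimes> word (\<alpha> # \<alpha>s) \<beta>s = \<ominus> (ad (v \<alpha>) \<otimes> (ad h \<otimes> word \<alpha>s \<beta>s))"
  by (simp add: word_Cons_left m_assoc[symmetric] anticommute_ad_ad[of h] l_minus)

lemma ad_word_Cons_right:
  "ad h \<otimes> word [] (\<beta> # \<beta>s) =
    cscale A (cinner h (v \<beta>)) (word [] \<beta>s) \<ominus> a (v \<beta>) \<otimes> (ad h \<otimes> word [] \<beta>s)"
  by (simp add: word_Cons_right m_assoc[symmetric] ad_a_eq)
     (simp add: a_minus_def l_distr l_minus cscale_mult_left cscale_closed m_assoc)

lemma approx_diff: "x \<in> approx \<Longrightarrow> y \<in> approx \<Longrightarrow> x \<ominus> y \<in> approx"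
  by (simp add: a_minus_def approx_add approx_minus)

text \<open>Left multiplication by \<open>a(v\<^sub>\<gamma>)\<close> or \<open>a(v\<^sub>\<gamma>)\<^sup>*\<close> preserves \<open>approx\<close>: the two kinds of creators only
  lengthen excitation monomials, and an annihilator can be moved to the right, at the cost of shorter
  monomials, until it meets the vacuum.\<close>

lemma approx_ad_empty:
  assumes \<alpha>: "\<alpha> \<in> I - I0" and x: "x \<in> approx"
  shows "ad (v \<alpha>) \<otimes> x \<in> approx"
proof (rule approx_letter[OF _ _ x])
  show "ad (v \<alpha>) \<otimes> word \<alpha>s \<beta>s \<in> approx" if "set \<alpha>s \<subseteq> I - I0" "set \<beta>s \<subseteq> I0" for \<alpha>s \<beta>s
    using word_approx[of "\<alpha> # \<alpha>s" \<beta>s] that \<alpha> by (simp add: word_Cons_left)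
qed simp

lemma approx_a_filled:
  assumes \<beta>: "\<beta> \<in> I0" and x: "x \<in> approx"
  shows "a (v \<beta>) \<otimes> x \<in> approx"
proof (rule approx_letter[OF _ _ x])
  show "a (v \<beta>) \<otimes> word \<alpha>s \<beta>s \<in> approx" if "set \<alpha>s \<subseteq> I - I0" "set \<beta>s \<subseteq> I0" for \<alpha>s \<beta>s
    using that
  proof (induction \<alpha>s)
    case Nil
    then show ?case
      using word_approx[of "[]" "\<beta> # \<beta>s"] \<beta> by (simp add: word_Cons_right)
  next
    case (Cons \<alpha> \<alpha>s)
    then have "ad (v \<alpha>) \<otimes> (a (v \<beta>) \<otimes> word \<alpha>s \<beta>s) \<in> approx" "word \<alpha>s \<beta>s \<in> approx"
      by (auto intro!: approx_ad_empty word_approx)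
    then show ?case
      by (simp add: a_word_Cons_left approx_diff approx_cscale)
  qed
qed simp

lemma approx_a_empty:
  assumes \<alpha>: "\<alpha> \<in> I - I0" and x: "x \<in> approx"
  shows "a (v \<alpha>) \<otimes> x \<in> approx"
proof (rule approx_letter[OF _ _ x])
  show "a (v \<alpha>) \<otimes> word \<alpha>s \<beta>s \<in> approx" if "set \<alpha>s \<subseteq> I - I0" "set \<beta>s \<subseteq> I0" for \<alpha>s \<beta>s
    using that
  proof (induction \<alpha>s)
    case Nil
    from Nil(2) show ?case
    proof (induction \<beta>s)
      case Nil
      show ?case
        using \<alpha> by (auto intro!: approx_null simp: vacuum_def)
    next
      case (Cons \<beta> \<beta>s)
      then show ?case
        by (simp add: a_word_Cons_right approx_minus approx_a_filled)
    qed
  next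
    case (Cons \<alpha>' \<alpha>s)
    then have "ad (v \<alpha>') \<otimes> (a (v \<alpha>) \<otimes> word \<alpha>s \<beta>s) \<in> approx" "word \<alpha>s \<beta>s \<in> approx"
      by (auto intro!: approx_ad_empty word_approx)
    then show ?case
      by (simp add: a_word_Cons_left approx_diff approx_cscale)
  qed
qed simp

lemma approx_ad_filled:
  assumes \<beta>: "\<beta> \<in> I0" and x: "x \<in> approx"
  shows "ad (v \<beta>) \<otimes> x \<in> approx"
proof (rule approx_letter[OF _ _ x])
  show "ad (v \<beta>) \<otimes> word \<alpha>s \<beta>s \<in> approx" if "set \<alpha>s \<subseteq> I - I0" "set \<beta>s \<subseteq> I0" for \<alpha>s \<beta>s
    using that
  proof (induction \<alpha>s)
    case Nil
    from Nil(2) show ?case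
    proof (induction \<beta>s)
      case Nil
      show ?case
        using \<beta> by (auto intro!: approx_null simp: vacuum_def)
    next
      case (Cons \<beta>' \<beta>s)
      then show ?case
        by (simp add: ad_word_Cons_right approx_diff approx_cscale approx_a_filled word_approx)
    qed
  next
    case (Cons \<alpha> \<alpha>s)
    then show ?case
      by (simp add: ad_word_Cons_left approx_minus approx_ad_empty)
  qed
qed simp

lemma approx_mult_limit:
  assumes s: "s \<in> carrier A" and y: "y \<in> approx"
    and lim: "\<And>e. e > 0 \<Longrightarrow> \<exists>s'\<in>carrier A. cnorm A (s' \<ominus> s) < e \<and> s' \<otimes> y \<in> approx"
  shows "s \<otimes> y \<in> approx"
proof (rule approx_limit)
  note yc = approx_closed[OF y]
  show "s \<otimes> y \<in> carrier A"
    by (simp add: s yc)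
  fix e :: real assume e: "e > 0"
  define n where "n = (cnorm A y)\<^sup>2 + 1"
  have n: "n > 0"
    by (simp add: n_def add_nonneg_pos)
  obtain s' where s': "s' \<in> carrier A" "cnorm A (s' \<ominus> s) < min 1 (e / n)" "s' \<otimes> y \<in> approx"
    using lim[of "min 1 (e / n)"] e n by auto
  have "near (s \<otimes> y) (s' \<otimes> y) e"
    unfolding near_def
  proof (intro allI impI)
    fix \<psi> assume \<psi>: "vacuum \<psi>"
    note st = vacuum_state[OF \<psi>]
    define d where "d = cnorm A (s \<ominus> s')"
    have d: "0 \<le> d" "d < 1" "d < e / n"
      using s' s by (simp_all add: d_def cnorm_nonneg cnorm_diff_commute[of s])
    have "s \<otimes> y \<ominus> s' \<otimes> y = (s \<ominus> s') \<otimes> y"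
      using s s'(1) yc by algebra
    then have "sq_norm \<psi> (s \<otimes> y \<ominus> s' \<otimes> y) \<le> d\<^sup>2 * sq_norm \<psi> y"
      using sq_norm_mult_le[OF st, of "s \<ominus> s'" y] s s'(1) yc by (simp add: d_def)
    also have "\<dots> \<le> d * n"
    proof (rule mult_mono)
      show "d\<^sup>2 \<le> d"
        using d mult_left_mono[of d 1 d] by (simp add: power2_eq_square)
      show "sq_norm \<psi> y \<le> n"
        using sq_norm_le[OF st yc] by (simp add: n_def)
    qed (use d sq_norm_nonneg[OF st yc] in simp_all)
    also have "\<dots> \<le> e"
      using d(3) n by (simp add: pos_less_divide_eq)
    finally show "sq_norm \<psi> (s \<otimes> y \<ominus> s' \<otimes> y) \<le> e" .
  qed
  then show "\<exists>z\<in>approx. near (s \<otimes> y) z e"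
    using s'(3) by blast
qed

text \<open>The elements that preserve \<open>approx\<close> together with their adjoints form a closed *-subalgebra,
  which contains all generators.\<close>

lemma approx_all: "approx = carrier A"
proof -
  define S where "S = {s \<in> carrier A. \<forall>x\<in>approx. s \<otimes> x \<in> approx \<and> star A s \<otimes> x \<in> approx}"
  have S: "s \<in> carrier A" "x \<in> approx \<Longrightarrow> s \<otimes> x \<in> approx" "x \<in> approx \<Longrightarrow> star A s \<otimes> x \<in> approx"
    if "s \<in> S" for s x
    using that by (auto simp: S_def)
  have "closed_star_subalgebra A S"
    unfolding closed_star_subalgebra_def
  proof (intro conjI ballI allI impI)
    show "S \<subseteq> carrier A"
      by (auto simp: S_def)
    show "\<one> \<in> S"
      by (simp add: S_def approx_closed)
    show "x \<oplus> y \<in> S" if "x \<in> S" "y \<in> S" for x y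
      using S[OF that(1)] S[OF that(2)]
      by (simp add: S_def star_add star_closed l_distr approx_closed approx_add)
    show "x \<otimes> y \<in> S" if "x \<in> S" "y \<in> S" for x y
      using S[OF that(1)] S[OF that(2)]
      by (simp add: S_def star_mult star_closed m_assoc approx_closed)
    show "star A x \<in> S" if "x \<in> S" for x
      using S[OF that] by (simp add: S_def star_closed star_star)
    show "cscale A c x \<in> S" if "x \<in> S" for x c
      using S[OF that]
      by (simp add: S_def star_closed star_cscale cscale_closed cscale_mult_left approx_closed approx_cscale)
  next
    fix X :: "nat \<Rightarrow> 'a" and x
    assume x: "x \<in> carrier A" and X: "range X \<subseteq> S" and lim: "(\<lambda>n. cnorm A (X n \<ominus> x)) \<longlonglongrightarrow> 0"
    have XS: "X n \<in> S" for n
      using X by auto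
    have star: "cnorm A (star A (X n) \<ominus> star A x) = cnorm A (X n \<ominus> x)" for n
      using cnorm_star[of "X n \<ominus> x"] S(1)[OF XS] x by (simp add: star_diff)
    have ex: "\<exists>n. cnorm A (X n \<ominus> x) < e" if "e > 0" for e
      using eventually_happens[OF order_tendstoD(2)[OF lim that]] by auto
    have "x \<otimes> y \<in> approx" if y: "y \<in> approx" for y
      by (rule approx_mult_limit[OF x y]) (use ex S(1,2)[OF XS] y in blast)
    moreover have "star A x \<otimes> y \<in> approx" if y: "y \<in> approx" for y
    proof (rule approx_mult_limit[OF star_closed[OF x] y])
      fix e :: real assume "e > 0"
      then obtain n where "cnorm A (star A (X n) \<ominus> star A x) < e"
        using ex by (auto simp: star)
      then show "\<exists>s'\<in>carrier A. cnorm A (s' \<ominus> star A x) < e \<and> s' \<otimes> y \<in> approx"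
        using star_closed[OF S(1)[OF XS[of n]]] S(3)[OF XS[of n] y] by blast
    qed
    ultimately show "x \<in> S"
      using x by (simp add: S_def)
  qed
  note closed = this
  have limit: "x \<in> S"
    if "x \<in> carrier A" "range X \<subseteq> S" "(\<lambda>n. cnorm A (X n \<ominus> x)) \<longlonglongrightarrow> 0" for X x
    using closed that unfolding closed_star_subalgebra_def by blast
  have basis: "a (v \<gamma>) \<in> S" if "\<gamma> \<in> I" for \<gamma>
    using that approx_ad_empty approx_ad_filled approx_a_empty approx_a_filled
    by (cases "\<gamma> \<in> I0") (auto simp: S_def)
  have "a h \<in> S" if "h \<in> cspan (v ` I)" for h
    using that
  proof (induction rule: complex_vector.span_induct_alt)
    case base
    then show ?case
      using closed unfolding closed_star_subalgebra_def
      by (metis a_zero cscale_zero one_closed)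
  next
    case (step c x y)
    then show ?case
      using closed basis by (auto simp: closed_star_subalgebra_def a_add a_scaleC)
  qed
  note span = this
  have "a h \<in> S" for h
  proof -
    have "h \<in> closure (cspan (v ` I))"
      using onb by (simp add: orthonormal_basis_def)
    then obtain k where k: "\<And>n. k n \<in> cspan (v ` I)" "k \<longlonglongrightarrow> h"
      by (auto simp: closure_sequential)
    have "(\<lambda>n. norm (k n - h)) \<longlonglongrightarrow> 0"
      using k(2) by (simp add: LIM_zero_iff tendsto_norm_zero_iff)
    then have "(\<lambda>n. cnorm A (a (k n) \<ominus> a h)) \<longlonglongrightarrow> 0"
      by (rule Lim_null_comparison[rotated])
         (use cnorm_a_le[of "k n - h" for n] cnorm_nonneg in \<open>auto simp: a_diff\<close>)
    then show ?thesis
      using span[OF k(1)] by (intro limit[of "a h" "\<lambda>n. a (k n)"]) auto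
  qed
  then have "S = carrier A"
    using generated[OF closed] by blast
  then have "x \<otimes> \<one> \<in> approx" if "x \<in> carrier A" for x
    using that words_approx[OF word_in_words[of "[]" "[]" UNIV]] by (simp add: S_def del: r_one) blast
  then show ?thesis
    using approx_closed by auto
qed

text \<open>A vacuum state composed with a gauge transformation is again a vacuum state, since the
  annihilators only pick up phases.\<close>

lemma gauge_near:
  assumes z: "cmod z = 1" and x: "x \<in> gicar A a" and y: "y \<in> carrier A" and near: "near x y e"
  shows "near x (gauge z y) e"
  unfolding near_def
proof (intro allI impI)
  fix \<psi> assume \<psi>: "vacuum \<psi>"
  note g = gauge_hom[OF z]
  note st = vacuum_state[OF \<psi>]
  have "vacuum (\<psi> \<circ> gauge z)"
    using \<psi> by (simp add: vacuum_def is_state_comp[OF g] sq_norm_comp[OF g st] gauge_a[OF z]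
        star_homD[OF g] star_cscale sq_norm_cscale[OF st])
  then have "sq_norm \<psi> (gauge z (x \<ominus> y)) \<le> e"
    using near x y by (simp add: near_def gicar_closed flip: sq_norm_comp[OF g st])
  then show "sq_norm \<psi> (x \<ominus> gauge z y) \<le> e"
    using x y z by (simp add: star_hom_diff[OF g] gicar_iff)
qed

text \<open>A gauge-invariant element is approximated by gauge-invariant combinations: starting from any
  approximation, the finitely many nonzero degrees are averaged away one at a time.\<close>

lemma gicar_approx:
  assumes x: "x \<in> gicar A a" and e: "e > 0"
  shows "\<exists>y\<in>words {0}. near x y e"
proof -
  have remove: "\<exists>y\<in>words {0}. near x y e" if "finite F" "y \<in> words (insert 0 F)" "near x y e" for F y
    using that
  proof (induction F arbitrary: y rule: finite_induct)
    case empty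
    then show ?case by auto
  next
    case (insert d F)
    show ?case
    proof (cases "d = 0")
      case True
      then show ?thesis
        using insert by (intro insert.IH) auto
    next
      case False
      let ?g = "gauge (cis (pi / of_int d))"
      let ?y = "cscale A (1/2) (y \<oplus> ?g y)"
      note yc = words_closed[OF insert.prems(1)]
      have gy: "?g y \<in> carrier A"
        by (simp add: star_homD(1)[OF gauge_hom] yc)
      have "?y \<in> words (insert 0 (insert d F) - {d})"
        by (rule gauge_average_kills_degree[OF False insert.prems(1)])
      then have y': "?y \<in> words (insert 0 F)"
        by (rule words_mono) auto
      have xc: "x \<in> carrier A"
        by (rule gicar_closed[OF x])
      have near': "near x (?g y) e"
        by (rule gauge_near[OF _ x yc insert.prems(2)]) simp
      have "(x \<ominus> y) \<oplus> (x \<ominus> ?g y) = (x \<oplus> x) \<ominus> (y \<oplus> ?g y)"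
        using xc yc gy by algebra
      then have avg: "x \<ominus> ?y = cscale A (1/2) ((x \<ominus> y) \<oplus> (x \<ominus> ?g y))"
        using xc yc gy by (simp add: cscale_diff_right cscale_half_double)
      have "near x ?y e"
        unfolding near_def avg
      proof (intro allI impI)
        fix \<psi> assume "vacuum \<psi>"
        then show "sq_norm \<psi> (cscale A (1/2) ((x \<ominus> y) \<oplus> (x \<ominus> ?g y))) \<le> e"
          using insert.prems(2) near' xc yc gy
          by (intro sq_norm_average_le vacuum_state) (auto simp: near_def)
      qed
      with y' show ?thesis
        by (rule insert.IH)
    qed
  qed
  have "x \<in> approx"
    using x by (simp add: approx_all gicar_closed)
  then obtain y where y: "y \<in> words UNIV" "near x y e"
    using e by (auto simp: approx_def)
  obtain F where F: "finite F" "y \<in> words F"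
    using words_finite_degrees[OF y(1)] by blast
  then show ?thesis
    using remove[OF F(1) words_mono[OF F(2)] y(2)] by blast
qed


section \<open>Number operators\<close>

text \<open>Commutation with \<open>N = a(v\<^sub>\<gamma>)\<^sup>* a(v\<^sub>\<gamma>)\<close> is a derivation that has the generators as eigenvectors,
  with eigenvalue \<open>1\<close> on \<open>a(v\<^sub>\<gamma>)\<^sup>*\<close>, \<open>-1\<close> on \<open>a(v\<^sub>\<gamma>)\<close> and \<open>0\<close> on those of the other basis vectors. On a
  monomial the eigenvalues add up to a difference of multiplicities.\<close>

lemma number_ad:
  assumes "\<gamma> \<in> I" "\<alpha> \<in> I"
  shows "(ad (v \<gamma>) \<otimes> a (v \<gamma>)) \<otimes> ad (v \<alpha>) =
    ad (v \<alpha>) \<otimes> (ad (v \<gamma>) \<otimes> a (v \<gamma>)) \<oplus> cscale A (of_bool (\<alpha> = \<gamma>)) (ad (v \<alpha>))"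
proof -
  have "(ad (v \<gamma>) \<otimes> a (v \<gamma>)) \<otimes> ad (v \<alpha>) =
      cscale A (cinner (v \<alpha>) (v \<gamma>)) (ad (v \<gamma>)) \<ominus> (ad (v \<gamma>) \<otimes> ad (v \<alpha>)) \<otimes> a (v \<gamma>)"
    by (simp add: m_assoc a_ad_eq a_minus_def r_distr r_minus cscale_mult_right cscale_closed)
  also have "ad (v \<gamma>) \<otimes> ad (v \<alpha>) = \<ominus> (ad (v \<alpha>) \<otimes> ad (v \<gamma>))"
    by (rule anticommute_ad_ad)
  also have "cscale A (cinner (v \<alpha>) (v \<gamma>)) (ad (v \<gamma>)) = cscale A (of_bool (\<alpha> = \<gamma>)) (ad (v \<alpha>))"
    using assms by (simp add: cinner_basis)
  finally show ?thesis
    by (simp add: a_minus_def l_minus m_assoc cscale_closed a_comm)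
qed

lemma number_a:
  assumes "\<gamma> \<in> I" "\<beta> \<in> I"
  shows "(ad (v \<gamma>) \<otimes> a (v \<gamma>)) \<otimes> a (v \<beta>) =
    a (v \<beta>) \<otimes> (ad (v \<gamma>) \<otimes> a (v \<gamma>)) \<oplus> cscale A (- of_bool (\<beta> = \<gamma>)) (a (v \<beta>))"
proof -
  have "(ad (v \<gamma>) \<otimes> a (v \<gamma>)) \<otimes> a (v \<beta>) = \<ominus> ((ad (v \<gamma>) \<otimes> a (v \<beta>)) \<otimes> a (v \<gamma>))"
    by (simp add: m_assoc anticommute_a_a[of "v \<gamma>" "v \<beta>"] r_minus)
  also have "\<dots> = a (v \<beta>) \<otimes> (ad (v \<gamma>) \<otimes> a (v \<gamma>)) \<oplus> cscale A (- cinner (v \<gamma>) (v \<beta>)) (a (v \<gamma>))"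
    unfolding ad_a_eq[of "v \<gamma>" "v \<beta>"]
    by (simp add: a_minus_def l_distr l_minus minus_add cscale_mult_left cscale_closed
        m_assoc a_comm cscale_uminus)
  also have "cscale A (- cinner (v \<gamma>) (v \<beta>)) (a (v \<gamma>)) = cscale A (- of_bool (\<beta> = \<gamma>)) (a (v \<beta>))"
    using assms by (simp add: cinner_basis)
  finally show ?thesis .
qed

lemma derivation_step:
  assumes N: "N \<in> carrier A" and b: "b \<in> carrier A" and w: "w \<in> carrier A"
    and Nb: "N \<otimes> b = b \<otimes> N \<oplus> cscale A c b" and Nw: "N \<otimes> w = w \<otimes> N \<oplus> cscale A d w"
    and e: "e = c + d"
  shows "N \<otimes> (b \<otimes> w) = (b \<otimes> w) \<otimes> N \<oplus> cscale A e (b \<otimes> w)"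
proof -
  have "N \<otimes> (b \<otimes> w) = b \<otimes> (N \<otimes> w) \<oplus> cscale A c (b \<otimes> w)"
    using N b w by (simp add: m_assoc[symmetric] Nb l_distr cscale_closed cscale_mult_left)
  also have "\<dots> = (b \<otimes> w) \<otimes> N \<oplus> cscale A e (b \<otimes> w)"
    using N b w
    by (simp add: e Nw r_distr cscale_closed cscale_mult_right cscale_add_left m_assoc a_ac)
  finally show ?thesis .
qed

lemma number_word:
  assumes \<gamma>: "\<gamma> \<in> I" and "set \<alpha>s \<subseteq> I" "set \<beta>s \<subseteq> I"
  shows "(ad (v \<gamma>) \<otimes> a (v \<gamma>)) \<otimes> word \<alpha>s \<beta>s = word \<alpha>s \<beta>s \<otimes> (ad (v \<gamma>) \<otimes> a (v \<gamma>)) \<oplus>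
    cscale A (of_nat (count_list \<alpha>s \<gamma>) - of_nat (count_list \<beta>s \<gamma>)) (word \<alpha>s \<beta>s)"
  using assms(2)
proof (induction \<alpha>s)
  case Nil
  from assms(3) show ?case
  proof (induction \<beta>s)
    case Nil
    then show ?case by simp
  next
    case (Cons \<beta> \<beta>s)
    then show ?case
      unfolding word_Cons_right
      by (intro derivation_step[OF _ _ _ number_a[OF \<gamma>]]) auto
  qed
next
  case (Cons \<alpha> \<alpha>s)
  then show ?case
    unfolding word_Cons_left
    by (intro derivation_step[OF _ _ _ number_ad[OF \<gamma>]]) auto
qed

end

section \<open>The second-quantized operator\<close>

text \<open>The two-point function of \<open>\<phi>\<close> is \<open>\<langle>K h, h\<rangle>\<close>, and \<open>K\<close> fixes the \<open>v\<^sub>\<beta>\<close> with \<open>\<beta> \<in> I0\<close> and kills the other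
  basis vectors.\<close>

lemma (in car_basis) quasi_free_vacuum:
  assumes K: "orth_proj_onto (closure (cspan (v ` I0))) K" and \<phi>: "is_quasi_free_state A a K \<phi>"
  shows "vacuum \<phi>"
proof -
  have st: "is_state A \<phi>"
    and form: "\<And>hs ks. \<phi> (mprod A (map (\<lambda>h. ad h) (rev hs) @ map a ks)) =
        (if length hs = length ks
         then Determinant.det
           (Matrix.mat (length hs) (length hs) (\<lambda>(i, j). cinner (K (hs ! i)) (ks ! j)))
         else 0)"
    using \<phi> by (simp_all add: is_quasi_free_state_def)
  have two_point: "\<phi> (ad h \<otimes> a h) = cinner (K h) h" for h
    using form[of "[h]" "[h]"] by (simp add: det_single)
  have filled: "K (v \<beta>) = v \<beta>" if "\<beta> \<in> I0" for \<beta>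
    using that
    by (intro orth_proj_fixes[OF K] subsetD[OF closure_subset] complex_vector.span_base) auto
  have empty: "K (v \<alpha>) = 0" if \<alpha>: "\<alpha> \<in> I - I0" for \<alpha>
  proof (rule orth_proj_orthogonal[OF K])
    have span: "cinner (v \<alpha>) y = 0" if "y \<in> cspan (v ` I0)" for y
      using that
    proof (induction rule: complex_vector.span_induct_alt)
      case (step c x y)
      then show ?case
        using \<alpha> I0 by (auto simp: cinner_simps cinner_basis subset_iff split: if_splits)
    qed simp
    fix y assume "y \<in> closure (cspan (v ` I0))"
    then obtain k where k: "\<And>n. k n \<in> cspan (v ` I0)" "k \<longlonglongrightarrow> y"
      by (auto simp: closure_sequential)
    have "(\<lambda>n. cinner (v \<alpha>) (k n)) \<longlonglongrightarrow> cinner (v \<alpha>) y"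
      by (intro tendsto_cinner tendsto_const k)
    then show "cinner (v \<alpha>) y = 0"
      by (simp add: span[OF k(1)] LIMSEQ_const_iff)
  qed
  have "sq_norm \<phi> (a (v \<alpha>)) = 0" if "\<alpha> \<in> I - I0" for \<alpha>
    using that by (simp add: sq_norm_def two_point empty)
  moreover have "sq_norm \<phi> (ad (v \<beta>)) = 0" if "\<beta> \<in> I0" for \<beta>
    using that I0
    by (simp add: sq_norm_def star_star a_ad_eq state_diff[OF st] state_cscale[OF st]
        state_one[OF st] cscale_closed two_point filled)
  ultimately show ?thesis
    using st by (simp add: vacuum_def)
qed

locale car_gns = car_basis A a v I I0
  for A :: "'a cstar_alg" (structure) and a :: "'h::complex_inner \<Rightarrow> 'a"
    and v :: "'i \<Rightarrow> 'h" and I I0 +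
  fixes \<phi> :: "'a \<Rightarrow> complex" and \<rho> :: "'a \<Rightarrow> 'k::complex_hilbert \<Rightarrow> 'k" and \<Omega> :: 'k
    and m :: "'i \<Rightarrow> real"
  assumes vacuum: "vacuum \<phi>" and gns: "gns_triple A (gicar A a) \<phi> \<rho> \<Omega>"
begin

lemma
  shows rho_clinear: "x \<in> gicar A a \<Longrightarrow> bounded_clinear (\<rho> x)"
    and rho_add: "\<lbrakk>x \<in> gicar A a; y \<in> gicar A a\<rbrakk> \<Longrightarrow> \<rho> (x \<oplus> y) \<xi> = \<rho> x \<xi> + \<rho> y \<xi>"
    and rho_mult: "\<lbrakk>x \<in> gicar A a; y \<in> gicar A a\<rbrakk> \<Longrightarrow> \<rho> (x \<otimes> y) \<xi> = \<rho> x (\<rho> y \<xi>)"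
    and rho_cscale: "x \<in> gicar A a \<Longrightarrow> \<rho> (cscale A c x) \<xi> = c *\<^sub>C \<rho> x \<xi>"
    and rho_star: "x \<in> gicar A a \<Longrightarrow> cinner (\<rho> (star A x) \<xi>) \<eta> = cinner \<xi> (\<rho> x \<eta>)"
    and rho_one: "\<rho> \<one> \<xi> = \<xi>"
    and rho_dense: "closure ((\<lambda>x. \<rho> x \<Omega>) ` gicar A a) = UNIV"
    and rho_state: "x \<in> gicar A a \<Longrightarrow> cinner (\<rho> x \<Omega>) \<Omega> = \<phi> x"
  using gns by (simp_all add: gns_triple_def)

lemma rho_diff: "\<lbrakk>x \<in> gicar A a; y \<in> gicar A a\<rbrakk> \<Longrightarrow> \<rho> (x \<ominus> y) \<xi> = \<rho> x \<xi> - \<rho> y \<xi>"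
  by (simp add: minus_eq_cscale gicar_closed rho_add rho_cscale gicar_cscale)

lemma norm_rho:
  assumes x: "x \<in> gicar A a"
  shows "(norm (\<rho> x \<Omega>))\<^sup>2 = sq_norm \<phi> x"
proof -
  have "\<phi> (star A x \<otimes> x) = cinner (\<rho> x \<Omega>) (\<rho> x \<Omega>)"
    using x by (simp add: rho_state[symmetric] gicar_mult gicar_star rho_mult rho_star)
  then show ?thesis
    by (simp add: sq_norm_def cinner_self)
qed

abbreviation exc :: "'i list \<Rightarrow> 'i list \<Rightarrow> 'k" where
  "exc \<equiv> excitation_vector A a \<rho> \<Omega> v"

lemma exc_eq: "exc \<alpha>s \<beta>s = \<rho> (word \<alpha>s \<beta>s) \<Omega>"
  by (simp add: excitation_vector_def word_def)

abbreviation exc_span :: "'k set" where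
  "exc_span \<equiv> excitation_span A a \<rho> \<Omega> v I I0"

lemma
  shows exc_span_zero: "0 \<in> exc_span"
    and exc_span_add: "x \<in> exc_span \<Longrightarrow> y \<in> exc_span \<Longrightarrow> x + y \<in> exc_span"
    and exc_span_scale: "x \<in> exc_span \<Longrightarrow> c *\<^sub>C x \<in> exc_span"
    and exc_in_span: "length \<alpha>s = length \<beta>s \<Longrightarrow> set \<alpha>s \<subseteq> I - I0 \<Longrightarrow> set \<beta>s \<subseteq> I0 \<Longrightarrow>
      exc \<alpha>s \<beta>s \<in> exc_span"
  unfolding excitation_span_def
  by (auto intro: complex_vector.span_zero complex_vector.span_add complex_vector.span_scale
      complex_vector.span_base)

lemma exc_span_induct [consumes 1, case_names zero step]:
  assumes "\<psi> \<in> exc_span" and "P 0"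
    and "\<And>c \<alpha>s \<beta>s \<psi>. \<lbrakk>length \<alpha>s = length \<beta>s; set \<alpha>s \<subseteq> I - I0; set \<beta>s \<subseteq> I0; P \<psi>\<rbrakk> \<Longrightarrow>
      P (c *\<^sub>C exc \<alpha>s \<beta>s + \<psi>)"
  shows "P \<psi>"
  using assms(1) unfolding excitation_span_def
  by (induction rule: complex_vector.span_induct_alt) (use assms(2,3) in auto)

lemma words_gicar: "x \<in> words {0} \<Longrightarrow> x \<in> gicar A a \<and> \<rho> x \<Omega> \<in> exc_span"
proof (induction rule: words.induct)
  case words_zero
  have "\<rho> \<zero> \<Omega> = 0"
    using rho_cscale[OF gicar_one, of 0 \<Omega>] by simp
  then show ?case
    by (simp add: gicar_zero exc_span_zero)
next
  case (words_step \<alpha>s \<beta>s x c)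
  then show ?case
    using exc_in_span[of \<alpha>s \<beta>s]
    by (simp add: gicar_add gicar_cscale word_gicar rho_add rho_cscale exc_span_add exc_span_scale
        exc_eq)
qed

text \<open>The distance between the vectors of two gauge-invariant elements is their distance in the
  seminorm of the vacuum state \<open>\<phi>\<close>, so the approximation in the algebra carries over.\<close>

lemma exc_span_dense: "closure exc_span = UNIV"
proof -
  have "\<rho> x \<Omega> \<in> closure exc_span" if x: "x \<in> gicar A a" for x
    unfolding closure_approachable
  proof (intro allI impI)
    fix e :: real assume e: "e > 0"
    then obtain y where y: "y \<in> words {0}" "near x y ((e/2)\<^sup>2)"
      using gicar_approx[OF x, of "(e/2)\<^sup>2"] by auto
    have yg: "y \<in> gicar A a" and ys: "\<rho> y \<Omega> \<in> exc_span"
      using words_gicar[OF y(1)] by auto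
    have "(norm (\<rho> x \<Omega> - \<rho> y \<Omega>))\<^sup>2 \<le> (e/2)\<^sup>2"
      using y(2) vacuum x yg norm_rho[OF gicar_diff[OF x yg]] by (simp add: near_def rho_diff)
    then have "norm (\<rho> x \<Omega> - \<rho> y \<Omega>) \<le> e/2"
      by (rule power2_le_imp_le) (use e in simp)
    then show "\<exists>z\<in>exc_span. dist z (\<rho> x \<Omega>) < e"
      using ys e by (intro bexI[of _ "\<rho> y \<Omega>"]) (auto simp: dist_norm norm_minus_commute)
  qed
  then have "closure ((\<lambda>x. \<rho> x \<Omega>) ` gicar A a) \<subseteq> closure exc_span"
    by (intro closure_minimal) auto
  then show ?thesis
    by (simp add: rho_dense top_unique)
qed

lemma rho_number_exc:
  assumes \<gamma>: "\<gamma> \<in> I" and len: "length \<alpha>s = length \<beta>s" and sets: "set \<alpha>s \<subseteq> I" "set \<beta>s \<subseteq> I"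
  shows "\<rho> (ad (v \<gamma>) \<otimes> a (v \<gamma>)) (exc \<alpha>s \<beta>s) = \<rho> (word \<alpha>s \<beta>s) (\<rho> (ad (v \<gamma>) \<otimes> a (v \<gamma>)) \<Omega>) +
    (real (count_list \<alpha>s \<gamma>) - real (count_list \<beta>s \<gamma>)) *\<^sub>R exc \<alpha>s \<beta>s"
proof -
  note g = word_gicar[OF len] ad_a_gicar[of "v \<gamma>"]
  have "\<rho> (ad (v \<gamma>) \<otimes> a (v \<gamma>)) (exc \<alpha>s \<beta>s) = \<rho> ((ad (v \<gamma>) \<otimes> a (v \<gamma>)) \<otimes> word \<alpha>s \<beta>s) \<Omega>"
    using g by (simp add: exc_eq rho_mult)
  then show ?thesis
    unfolding number_word[OF \<gamma> sets] using g
    by (simp add: rho_add rho_mult rho_cscale gicar_mult gicar_cscale exc_eq scaleR_eq_scaleC)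
qed

lemma rho_number_empty:
  assumes \<gamma>: "\<gamma> \<in> I - I0" and len: "length \<alpha>s = length \<beta>s"
    and sets: "set \<alpha>s \<subseteq> I - I0" "set \<beta>s \<subseteq> I0"
  shows "\<rho> (ad (v \<gamma>) \<otimes> a (v \<gamma>)) (exc \<alpha>s \<beta>s) = real (count_list \<alpha>s \<gamma>) *\<^sub>R exc \<alpha>s \<beta>s"
proof -
  have "sq_norm \<phi> (ad (v \<gamma>) \<otimes> a (v \<gamma>)) = 0"
    using \<gamma> vacuum by (intro sq_norm_mult_zero) (auto simp: vacuum_def)
  then have "\<rho> (ad (v \<gamma>) \<otimes> a (v \<gamma>)) \<Omega> = 0"
    using norm_rho[OF ad_a_gicar, of "v \<gamma>"] by simp
  moreover have "count_list \<beta>s \<gamma> = 0"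
    using \<gamma> sets by (auto simp: count_list_0_iff)
  ultimately show ?thesis
    using rho_number_exc[OF _ len, of \<gamma>] \<gamma> sets I0 bounded_clinearD(5)[OF rho_clinear[OF word_gicar[OF len]]]
    by auto
qed

text \<open>For an occupied index, \<open>a(v\<^sub>\<gamma>) a(v\<^sub>\<gamma>)\<^sup>* = 1 - a(v\<^sub>\<gamma>)\<^sup>* a(v\<^sub>\<gamma>)\<close> kills the vacuum and counts with
  the opposite sign.\<close>

lemma rho_number_filled:
  assumes \<gamma>: "\<gamma> \<in> I0" and len: "length \<alpha>s = length \<beta>s"
    and sets: "set \<alpha>s \<subseteq> I - I0" "set \<beta>s \<subseteq> I0"
  shows "\<rho> (a (v \<gamma>) \<otimes> ad (v \<gamma>)) (exc \<alpha>s \<beta>s) = real (count_list \<beta>s \<gamma>) *\<^sub>R exc \<alpha>s \<beta>s"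
proof -
  have \<gamma>I: "\<gamma> \<in> I"
    using \<gamma> I0 by auto
  have M: "\<rho> (a (v \<gamma>) \<otimes> ad (v \<gamma>)) \<xi> = \<xi> - \<rho> (ad (v \<gamma>) \<otimes> a (v \<gamma>)) \<xi>" for \<xi>
    using \<gamma>I by (simp add: a_ad_eq cinner_basis cscale_one rho_diff gicar_one ad_a_gicar rho_one)
  have "sq_norm \<phi> (a (v \<gamma>) \<otimes> ad (v \<gamma>)) = 0"
    using \<gamma> vacuum by (intro sq_norm_mult_zero) (auto simp: vacuum_def)
  then have "\<rho> (a (v \<gamma>) \<otimes> ad (v \<gamma>)) \<Omega> = 0"
    using norm_rho[OF a_ad_gicar, of "v \<gamma>"] by simp
  then have "\<rho> (ad (v \<gamma>) \<otimes> a (v \<gamma>)) \<Omega> = \<Omega>"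
    using M[of \<Omega>] by simp
  moreover have "count_list \<alpha>s \<gamma> = 0"
    using \<gamma> sets by (auto simp: count_list_0_iff)
  ultimately show ?thesis
    using rho_number_exc[OF \<gamma>I len] sets I0 by (auto simp: M exc_eq subset_iff)
qed

definition energy :: "'i list \<Rightarrow> 'i list \<Rightarrow> real" where
  "energy \<alpha>s \<beta>s = sum_list (map m \<alpha>s) - sum_list (map m \<beta>s)"

text \<open>The graph of the operator, with the convergence of its two sums recorded: linearity then
  follows from that of \<open>has_sum\<close>.\<close>

definition acts :: "'k \<Rightarrow> 'k \<Rightarrow> bool" where
  "acts \<psi> \<zeta> \<longleftrightarrow> \<psi> \<in> exc_span \<and> (\<exists>x y. \<zeta> = x - y \<and>
     ((\<lambda>\<alpha>. m \<alpha> *\<^sub>R \<rho> (ad (v \<alpha>) \<otimes> a (v \<alpha>)) \<psi>) has_sum x) (I - I0) \<and>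
     ((\<lambda>\<alpha>. m \<alpha> *\<^sub>R \<rho> (a (v \<alpha>) \<otimes> ad (v \<alpha>)) \<psi>) has_sum y) I0)"

lemma acts_zero: "acts 0 0"
  unfolding acts_def using exc_span_zero bounded_clinearD(5)[OF rho_clinear]
  by (auto intro!: exI[of _ 0] has_sum_0 simp: ad_a_gicar a_ad_gicar)

lemma acts_add:
  assumes "acts \<psi> \<zeta>" "acts \<psi>' \<zeta>'"
  shows "acts (\<psi> + \<psi>') (\<zeta> + \<zeta>')"
proof -
  from assms obtain x y x' y' where *: "\<psi> \<in> exc_span" "\<psi>' \<in> exc_span" "\<zeta> = x - y" "\<zeta>' = x' - y'"
    "((\<lambda>\<alpha>. m \<alpha> *\<^sub>R \<rho> (ad (v \<alpha>) \<otimes> a (v \<alpha>)) \<psi>) has_sum x) (I - I0)"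
    "((\<lambda>\<alpha>. m \<alpha> *\<^sub>R \<rho> (a (v \<alpha>) \<otimes> ad (v \<alpha>)) \<psi>) has_sum y) I0"
    "((\<lambda>\<alpha>. m \<alpha> *\<^sub>R \<rho> (ad (v \<alpha>) \<otimes> a (v \<alpha>)) \<psi>') has_sum x') (I - I0)"
    "((\<lambda>\<alpha>. m \<alpha> *\<^sub>R \<rho> (a (v \<alpha>) \<otimes> ad (v \<alpha>)) \<psi>') has_sum y') I0"
    unfolding acts_def by blast
  from has_sum_add[OF *(5,7)] has_sum_add[OF *(6,8)]
  have "((\<lambda>\<alpha>. m \<alpha> *\<^sub>R \<rho> (ad (v \<alpha>) \<otimes> a (v \<alpha>)) (\<psi> + \<psi>')) has_sum (x + x')) (I - I0)"
    "((\<lambda>\<alpha>. m \<alpha> *\<^sub>R \<rho> (a (v \<alpha>) \<otimes> ad (v \<alpha>)) (\<psi> + \<psi>')) has_sum (y + y')) I0"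
    by (simp_all add: bounded_clinearD(2)[OF rho_clinear] ad_a_gicar a_ad_gicar scaleR_add_right)
  then show ?thesis
    unfolding acts_def using *(1-4) by (intro conjI exc_span_add exI[of _ "x + x'"] exI[of _ "y + y'"]) auto
qed

lemma acts_scale:
  assumes "acts \<psi> \<zeta>"
  shows "acts (c *\<^sub>C \<psi>) (c *\<^sub>C \<zeta>)"
proof -
  from assms obtain x y where *: "\<psi> \<in> exc_span" "\<zeta> = x - y"
    "((\<lambda>\<alpha>. m \<alpha> *\<^sub>R \<rho> (ad (v \<alpha>) \<otimes> a (v \<alpha>)) \<psi>) has_sum x) (I - I0)"
    "((\<lambda>\<alpha>. m \<alpha> *\<^sub>R \<rho> (a (v \<alpha>) \<otimes> ad (v \<alpha>)) \<psi>) has_sum y) I0"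
    unfolding acts_def by blast
  note bl = has_sum_bounded_linear[OF bounded_linear_scaleC[of c]]
  have comm: "c *\<^sub>C r *\<^sub>R \<xi> = r *\<^sub>R c *\<^sub>C \<xi>" for r and \<xi> :: 'k
    by (simp add: scaleR_eq_scaleC scaleC_scaleC mult.commute)
  from bl[OF *(3)] bl[OF *(4)]
  have "((\<lambda>\<alpha>. m \<alpha> *\<^sub>R \<rho> (ad (v \<alpha>) \<otimes> a (v \<alpha>)) (c *\<^sub>C \<psi>)) has_sum (c *\<^sub>C x)) (I - I0)"
    "((\<lambda>\<alpha>. m \<alpha> *\<^sub>R \<rho> (a (v \<alpha>) \<otimes> ad (v \<alpha>)) (c *\<^sub>C \<psi>)) has_sum (c *\<^sub>C y)) I0"
    by (simp_all add: bounded_clinearD(4)[OF rho_clinear] ad_a_gicar a_ad_gicar comm)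
  then show ?thesis
    unfolding acts_def using *(1,2)
    by (intro conjI exc_span_scale exI[of _ "c *\<^sub>C x"] exI[of _ "c *\<^sub>C y"]) (auto simp: scaleC_diff_right)
qed

lemma has_sum_count_list:
  fixes \<psi> :: 'k
  assumes "set xs \<subseteq> S" and f: "\<And>\<gamma>. \<gamma> \<in> S \<Longrightarrow> f \<gamma> = real (count_list xs \<gamma>) *\<^sub>R \<psi>"
  shows "((\<lambda>\<gamma>. m \<gamma> *\<^sub>R f \<gamma>) has_sum (sum_list (map m xs) *\<^sub>R \<psi>)) S"
proof (rule has_sum_finite_neutralI[where B="set xs"])
  have "sum_list (map m xs) = (\<Sum>\<gamma>\<in>set xs. m \<gamma> * real (count_list xs \<gamma>))"
  proof (induction xs)
    case (Cons x xs)
    have "(\<Sum>\<gamma>\<in>set (x # xs). m \<gamma> * real (count_list (x # xs) \<gamma>)) =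
        (\<Sum>\<gamma>\<in>set (x # xs). m \<gamma> * real (count_list xs \<gamma>) + (if \<gamma> = x then m x else 0))"
      by (intro sum.cong) (auto simp: distrib_left)
    also have "\<dots> = (\<Sum>\<gamma>\<in>set (x # xs). m \<gamma> * real (count_list xs \<gamma>)) + m x"
      by (simp only: sum.distrib) (simp add: sum.delta)
    also have "(\<Sum>\<gamma>\<in>set (x # xs). m \<gamma> * real (count_list xs \<gamma>)) = (\<Sum>\<gamma>\<in>set xs. m \<gamma> * real (count_list xs \<gamma>))"
      by (rule sum.mono_neutral_right) (auto simp: count_list_0_iff)
    finally show ?case
      using Cons by simp
  qed simp
  then show "sum_list (map m xs) *\<^sub>R \<psi> = (\<Sum>\<gamma>\<in>set xs. m \<gamma> *\<^sub>R f \<gamma>)"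
    using assms by (simp add: scaleR_sum_left f subset_iff)
  show "\<gamma> \<in> S - set xs \<Longrightarrow> m \<gamma> *\<^sub>R f \<gamma> = 0" for \<gamma>
    using f by (simp add: count_list_0_iff)
qed (use assms in auto)

lemma acts_exc:
  assumes "length \<alpha>s = length \<beta>s" "set \<alpha>s \<subseteq> I - I0" "set \<beta>s \<subseteq> I0"
  shows "acts (exc \<alpha>s \<beta>s) (energy \<alpha>s \<beta>s *\<^sub>R exc \<alpha>s \<beta>s)"
  unfolding acts_def
proof (intro conjI exI)
  show "((\<lambda>\<alpha>. m \<alpha> *\<^sub>R \<rho> (ad (v \<alpha>) \<otimes> a (v \<alpha>)) (exc \<alpha>s \<beta>s)) has_sum
      (sum_list (map m \<alpha>s) *\<^sub>R exc \<alpha>s \<beta>s)) (I - I0)"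
    by (rule has_sum_count_list[OF assms(2) rho_number_empty[OF _ assms]])
  show "((\<lambda>\<alpha>. m \<alpha> *\<^sub>R \<rho> (a (v \<alpha>) \<otimes> ad (v \<alpha>)) (exc \<alpha>s \<beta>s)) has_sum
      (sum_list (map m \<beta>s) *\<^sub>R exc \<alpha>s \<beta>s)) I0"
    by (rule has_sum_count_list[OF assms(3) rho_number_filled[OF _ assms]])
qed (simp_all add: exc_in_span assms energy_def scaleR_diff_left)

lemma exc_span_acts: "\<psi> \<in> exc_span \<Longrightarrow> \<exists>\<zeta>. acts \<psi> \<zeta>"
  by (induction rule: exc_span_induct) (use acts_zero acts_add acts_scale acts_exc in blast)+

lemma second_quantized_graph_eq:
  "second_quantized_graph A a \<rho> \<Omega> v m I I0 = {(\<psi>, \<zeta>). acts \<psi> \<zeta>}"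
proof -
  have eq: "\<zeta> = (\<Sum>\<^sub>\<infinity>\<alpha>\<in>I - I0. m \<alpha> *\<^sub>R \<rho> (ad (v \<alpha>) \<otimes> a (v \<alpha>)) \<psi>)
      - (\<Sum>\<^sub>\<infinity>\<alpha>\<in>I0. m \<alpha> *\<^sub>R \<rho> (a (v \<alpha>) \<otimes> ad (v \<alpha>)) \<psi>)" "\<psi> \<in> exc_span" if "acts \<psi> \<zeta>" for \<psi> \<zeta>
    using that by (auto simp: acts_def dest!: infsumI)
  then show ?thesis
    unfolding second_quantized_graph_def using exc_span_acts by fast
qed

text \<open>On an eigenvector with eigenvalue \<open>r\<close>, the operator plus \<open>\<i>\<close> is multiplication by
  \<open>r + \<i> \<noteq> 0\<close>.\<close>

lemma exc_span_range: "\<psi> \<in> exc_span \<Longrightarrow> \<exists>\<eta> \<zeta>. acts \<eta> \<zeta> \<and> \<zeta> + \<i> *\<^sub>C \<eta> = \<psi>"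
proof (induction rule: exc_span_induct)
  case zero
  then show ?case
    using acts_zero by fastforce
next
  case (step c \<alpha>s \<beta>s \<psi>)
  then obtain \<eta> \<zeta> where \<eta>: "acts \<eta> \<zeta>" "\<zeta> + \<i> *\<^sub>C \<eta> = \<psi>"
    by blast
  let ?r = "complex_of_real (energy \<alpha>s \<beta>s)" and ?e = "exc \<alpha>s \<beta>s"
  define d where "d = c / (?r + \<i>)"
  have r: "?r + \<i> \<noteq> 0"
    by (simp add: complex_eq_iff)
  have "acts (d *\<^sub>C ?e + \<eta>) (d *\<^sub>C energy \<alpha>s \<beta>s *\<^sub>R ?e + \<zeta>)"
    using step.hyps \<eta>(1) by (intro acts_add acts_scale acts_exc)
  moreover have "(d *\<^sub>C energy \<alpha>s \<beta>s *\<^sub>R ?e + \<zeta>) + \<i> *\<^sub>C (d *\<^sub>C ?e + \<eta>) = (d * (?r + \<i>)) *\<^sub>C ?e + (\<zeta> + \<i> *\<^sub>C \<eta>)"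
    by (simp add: scaleR_eq_scaleC scaleC_scaleC scaleC_add_right scaleC_add_left distrib_left mult.commute)
  ultimately show ?case
    using r \<eta>(2) by (auto simp: d_def)
qed

text \<open>An operator with a total family of eigenvectors is essentially self-adjoint, so a self-adjoint
  operator that shares these eigenvectors and eigenvalues is its closure.\<close>

lemma closure_second_quantized_graph:
  assumes T: "self_adjoint T"
    and eigen: "\<And>\<alpha>s \<beta>s. \<lbrakk>length \<alpha>s = length \<beta>s; set \<alpha>s \<subseteq> I - I0; set \<beta>s \<subseteq> I0\<rbrakk> \<Longrightarrow>
      (exc \<alpha>s \<beta>s, energy \<alpha>s \<beta>s *\<^sub>R exc \<alpha>s \<beta>s) \<in> T"
  shows "closure (second_quantized_graph A a \<rho> \<Omega> v m I I0) = T"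
  unfolding second_quantized_graph_eq
proof (rule closure_eq_self_adjoint[OF T])
  have unique: "\<zeta> = \<zeta>'" if "acts \<psi> \<zeta>" "acts \<psi> \<zeta>'" for \<psi> \<zeta> \<zeta>'
    using that unfolding acts_def by (auto dest!: infsumI)
  have T0: "(0, 0) \<in> T"
    and T_add: "\<And>x y x' y'. (x, y) \<in> T \<Longrightarrow> (x', y') \<in> T \<Longrightarrow> (x + x', y + y') \<in> T"
    and T_scale: "\<And>c x y. (x, y) \<in> T \<Longrightarrow> (c *\<^sub>C x, c *\<^sub>C y) \<in> T"
    using self_adjointD(1)[OF T] unfolding linear_graph_def by fast+
  have "\<exists>\<zeta>. acts \<psi> \<zeta> \<and> (\<psi>, \<zeta>) \<in> T" if "\<psi> \<in> exc_span" for \<psi>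
    using that
  proof (induction rule: exc_span_induct)
    case zero
    then show ?case using acts_zero T0 by blast
  next
    case (step c \<alpha>s \<beta>s \<psi>)
    then show ?case
      using acts_add acts_scale acts_exc T_add T_scale eigen by meson
  qed
  moreover have "\<psi> \<in> exc_span" if "acts \<psi> \<zeta>" for \<psi> \<zeta>
    using that by (simp add: acts_def)
  ultimately show "{(\<psi>, \<zeta>). acts \<psi> \<zeta>} \<subseteq> T"
    using unique by blast
  have "exc_span \<subseteq> (\<lambda>(x, y). y + \<i> *\<^sub>C x) ` {(\<psi>, \<zeta>). acts \<psi> \<zeta>}"
  proof
    fix \<psi> assume "\<psi> \<in> exc_span"
    then obtain \<eta> \<zeta> where "acts \<eta> \<zeta>" "\<psi> = \<zeta> + \<i> *\<^sub>C \<eta>"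
      using exc_span_range by blast
    then show "\<psi> \<in> (\<lambda>(x, y). y + \<i> *\<^sub>C x) ` {(\<psi>, \<zeta>). acts \<psi> \<zeta>}"
      by (intro image_eqI[of _ _ "(\<eta>, \<zeta>)"]) auto
  qed
  then show "closure ((\<lambda>(x, y). y + \<i> *\<^sub>C x) ` {(\<psi>, \<zeta>). acts \<psi> \<zeta>}) = UNIV"
    using closure_mono exc_span_dense by blast
qed

text \<open>Creators pick up the phases \<open>exp (\<i> t m\<^sub>\<alpha>)\<close> and annihilators their conjugates.\<close>

lemma rho_car_aut_exc:
  assumes V: "unitary_op V" and len: "length \<alpha>s = length \<beta>s"
    and eigen: "\<And>\<gamma>. \<gamma> \<in> set \<alpha>s \<union> set \<beta>s \<Longrightarrow> V (v \<gamma>) = cis (t * m \<gamma>) *\<^sub>C v \<gamma>"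
  shows "\<rho> (car_aut A a V (word \<alpha>s \<beta>s)) \<Omega> = cis (t * energy \<alpha>s \<beta>s) *\<^sub>C exc \<alpha>s \<beta>s"
proof -
  have "car_aut A a V (word \<alpha>s \<beta>s) = cscale A
      (prod_list (map (\<lambda>\<gamma>. cis (t * m \<gamma>)) \<alpha>s) * prod_list (map (\<lambda>\<gamma>. cnj (cis (t * m \<gamma>))) \<beta>s))
      (word \<alpha>s \<beta>s)"
    using eigen by (intro star_hom_word car_aut_props(1)[OF V])
      (simp add: car_aut_props(2)[OF V] a_scaleC)
  moreover have "prod_list (map (\<lambda>\<gamma>. cis (t * m \<gamma>)) xs) = cis (t * sum_list (map m xs))" for xs
    by (induction xs) (simp_all add: cis_mult distrib_left)
  moreover have "prod_list (map (\<lambda>\<gamma>. cnj (cis (t * m \<gamma>))) xs) = cis (- (t * sum_list (map m xs)))" for xs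
    by (induction xs) (simp_all add: cis_cnj cis_mult distrib_left)
  ultimately show ?thesis
    using word_gicar[OF len]
    by (simp add: rho_cscale exc_eq cis_mult energy_def right_diff_distrib)
qed

end

text \<open>\<open>V t\<close> multiplies an orthonormal basis by phases, and \<open>V (- t)\<close> inverts it there; both extend
  by continuity.\<close>

lemma unitary_if_eigenbasis:
  fixes V :: "real \<Rightarrow> 'h::complex_inner \<Rightarrow> 'h"
  assumes onb: "orthonormal_basis I v" and bc: "\<And>t. bounded_clinear (V t)"
    and eigen: "\<And>t \<alpha>. \<alpha> \<in> I \<Longrightarrow> V t (v \<alpha>) = cis (t * m \<alpha>) *\<^sub>C v \<alpha>"
  shows "unitary_op (V t)"
proof -
  note lin = bounded_clinearD[OF bc]
  have dense: "closure (cspan (v ` I)) = UNIV"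
    using onb by (simp add: orthonormal_basis_def)
  have "V t \<circ> V (- t) = id"
  proof (rule bounded_clinear_ext_dense[OF _ _ dense])
    show "bounded_clinear (V t \<circ> V (- t))"
      using bounded_linear_compose[OF lin(1) lin(1)] by (simp add: bounded_clinear_def o_def lin(4))
    show "bounded_clinear id"
      using bounded_linear_ident by (simp add: bounded_clinear_def id_def)
  qed (auto simp: eigen lin(4) scaleC_scaleC cis_mult)
  then have "V t (V (- t) x) = x" for x
    by (metis comp_apply id_apply)
  then have "surj (V t)"
    by (rule surjI)
  moreover have "cinner (V t x) (V t y) = cinner x y" for x y
  proof -
    have basis: "cinner (V t b) (V t b') = cinner b b'" if "b \<in> v ` I" "b' \<in> v ` I" for b b'
      using that onb
      by (auto simp: eigen cinner_simps orthonormal_basis_def cis_cnj cis_mult mult.assoc[symmetric])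
    have 1: "cinner (V t b) (V t y) = cinner b y" if "b \<in> v ` I" "y \<in> cspan (v ` I)" for b y
      using that(2)
      by (induction rule: complex_vector.span_induct_alt) (simp_all add: lin cinner_simps basis that(1))
    have 2: "cinner (V t x) (V t y) = cinner x y" if "x \<in> cspan (v ` I)" "y \<in> cspan (v ` I)" for x y
      using that(1)
      by (induction rule: complex_vector.span_induct_alt) (simp_all add: lin cinner_simps 1 that(2))
    have "x \<in> closure (cspan (v ` I))" "y \<in> closure (cspan (v ` I))"
      by (simp_all add: dense)
    then obtain p q where p: "\<And>n. p n \<in> cspan (v ` I)" "p \<longlonglongrightarrow> x"
      and q: "\<And>n. q n \<in> cspan (v ` I)" "q \<longlonglongrightarrow> y"
      by (auto simp: closure_sequential)
    have "(\<lambda>n. cinner (V t (p n)) (V t (q n))) \<longlonglongrightarrow> cinner (V t x) (V t y)"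
      by (intro tendsto_cinner bounded_linear.tendsto[OF lin(1)] p q)
    moreover have "(\<lambda>n. cinner (p n) (q n)) \<longlonglongrightarrow> cinner x y"
      by (intro tendsto_cinner p q)
    ultimately show ?thesis
      using LIMSEQ_unique by (simp add: 2[OF p(1) q(1)])
  qed
  ultimately show ?thesis
    using bc by (simp add: unitary_op_def)
qed

theorem theorem4p1:
  fixes A :: "('h::complex_hilbert \<times> 'h) set"
    and U :: "real \<Rightarrow> 'h \<Rightarrow> 'h"
    and I I0 :: "'i set"
    and v :: "'i \<Rightarrow> 'h"
    and m :: "'i \<Rightarrow> real"
    and K :: "'h \<Rightarrow> 'h"
    and CAR :: "'a cstar_alg"
    and a :: "'h \<Rightarrow> 'a"
    and \<phi> :: "'a \<Rightarrow> complex"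
    and \<rho> :: "'a \<Rightarrow> 'k::complex_hilbert \<Rightarrow> 'k"
    and \<Omega> :: 'k
    and \<Gamma> :: "real \<Rightarrow> 'k \<Rightarrow> 'k"
    and d\<Gamma> :: "('k \<times> 'k) set"
  assumes "separable_space (euclidean :: 'h topology)"
    and "self_adjoint A"
    and "countable I"
    and "orthonormal_basis I v"
    and "\<And>\<alpha>. \<alpha> \<in> I \<Longrightarrow> (v \<alpha>, m \<alpha> *\<^sub>R v \<alpha>) \<in> A"
    and "I0 \<subseteq> I"
    and "orth_proj_onto (closure (cspan (v ` I0))) K"
    and "is_car_algebra CAR a"
    and "is_quasi_free_state CAR a K \<phi>"
    and "gns_triple CAR (gicar CAR a) \<phi> \<rho> \<Omega>"
    and "is_exp_group A U"
    and "strongly_continuous_unitary_group \<Gamma>"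
    and "\<And>t x. x \<in> gicar CAR a \<Longrightarrow> \<Gamma> t (\<rho> x \<Omega>) = \<rho> (car_aut CAR a (U t) x) \<Omega>"
    and "self_adjoint d\<Gamma>"
    and "is_exp_group d\<Gamma> \<Gamma>"
  shows "closure (second_quantized_graph CAR a \<rho> \<Omega> v m I I0) = d\<Gamma>"
proof -
  interpret basis: car_basis CAR a v I I0
    using assms(4,6,8)
    by (simp add: car_basis_def car_basis_axioms_def car_algebra_def car_algebra_axioms_def
        is_car_algebra_def)
  interpret gns: car_gns CAR a v I I0 \<phi> \<rho> \<Omega> m
    by unfold_locales (use basis.quasi_free_vacuum[OF assms(7,9)] assms(10) in auto)
  have eigen: "U t (v \<alpha>) = cis (t * m \<alpha>) *\<^sub>C v \<alpha>" if "\<alpha> \<in> I" for t \<alpha>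
    by (rule exp_group_eigenvector[OF assms(2,11) assms(5)[OF that]])
  have "bounded_clinear (U t)" for t
    using assms(11) by (auto simp: is_exp_group_def)
  then have unitary: "unitary_op (U t)" for t
    by (rule unitary_if_eigenbasis[OF assms(4)]) (rule eigen)
  show ?thesis
  proof (rule gns.closure_second_quantized_graph[OF assms(14)])
    fix \<alpha>s \<beta>s assume *: "length \<alpha>s = length \<beta>s" "set \<alpha>s \<subseteq> I - I0" "set \<beta>s \<subseteq> I0"
    have "\<Gamma> t (gns.exc \<alpha>s \<beta>s) = cis (t * gns.energy \<alpha>s \<beta>s) *\<^sub>C gns.exc \<alpha>s \<beta>s" for t
      using * assms(6) unfolding gns.exc_eq assms(13)[OF basis.word_gicar[OF *(1)]]
      by (subst gns.rho_car_aut_exc[OF unitary *(1) eigen]) (auto simp: gns.exc_eq)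
    then show "(gns.exc \<alpha>s \<beta>s, gns.energy \<alpha>s \<beta>s *\<^sub>R gns.exc \<alpha>s \<beta>s) \<in> d\<Gamma>"
      by (rule exp_group_eigenvector_generator[OF assms(14,15)])
  qed
qed

end
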